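(* Let $\lambda\in(S^1)^n$ and let $\omega=s_{[a_k,b_k]}s_{[a_{k-1},b_{k-1}]}\cdots s_{[a_1,b_1]}$ be a reduced word in $\mathfrak S_{n+1}$, where $1\le k\le n$, $1\le b_k<b_{k-1}<\cdots<b_1\le n$ and $1\le a_i\le b_i$ for $1\le i\le k$. Then the representation $\psi_{\lambda,\omega}$ of $C(SU_0(n+1))$ is an irreducible representation.
   Context: Fix an integer $n\ge 2$. $C(SU_0(n+1))$ denotes the universal unital $C^*$-algebra generated by elements $z_{i,j}$, $1\le i,j\le n+1$, subject to the following relations (empty products are $1$): (1) $z_{i,j}z_{i,l}=0$ if $j<l$; (2) $z_{i,j}z_{k,j}=0$ if $i<k$; (3) $z_{i,l}z_{k,j}=z_{k,j}z_{i,l}$ if $i<k$ and $j<l$; (4) $z_{i,l}z_{k,j}=0$ if $i<k$, $j<l$ and $\max\{i,j\}\ge\min\{k,l\}$; (5) $z_{i,j}z_{k,l}-z_{k,l}z_{i,j}=z_{i,l}z_{k,j}$ if $i<k$, $j<l$ and $\max\{i,j\}+1=\min\{k,l\}$; (6) $z_{i,j}z_{k,l}=z_{k,l}z_{i,j}$ if $i<k$, $j<l$ and $\max\{i,j\}+1<\min\{k,l\}$; (7) $z_{1,1}z_{2,2}\cdots z_{n+1,n+1}=1$; (8) $z_{i,j}z_{r,s}^*=z_{r,s}^*z_{i,j}$ if $i\ne r$ and $j\neq s$; (9) $z_{r,s}^*=(z_{1,1}\cdots z_{s-1,s-1})(z_{s,s+1}z_{s+1,s+2}\cdots z_{r-1,r})(z_{r+1,r+1}\cdots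 z_{n+1,n+1})$ if $r>s$; $z_{r,s}^*=(z_{1,1}\cdots z_{r-1,r-1})(z_{r+1,r}z_{r+2,r+1}\cdots z_{s,s-1})(z_{s+1,s+1}\cdots z_{n+1,n+1})$ if $r<s$; $z_{r,r}^*=(z_{1,1}\cdots z_{r-1,r-1})(z_{r+1,r+1}\cdots z_{n+1,n+1})$. Words: $s_i=(i,i+1)$, $1\le i\le n$, are the transpositions generating the symmetric group $\mathfrak S_{n+1}$, and for $a\le b$, $s_{[a,b]}:=s_bs_{b-1}\cdots s_a$. The representations $\psi_{\lambda,\omega}$: $\mathbb N=\{0,1,2,\dots\}$; on $\ell^2(\mathbb N)$, $S$ is the left shift ($Se_m=e_{m-1}$ for $m\ge1$, $Se_0=0$) and $Ne_m=me_m$. For $0<q<1$ and $1\le r\le n$ let $\psi^{(q)}_{s_r}(u_{i,j})$ be the operator on $\ell^2(\mathbb N)$ equal to $S\sqrt{I-q^{2N}}$ if $i=j=r$; $\sqrt{I-q^{2N}}S^*$ if $i=j=r+1$; $-q^{N+1}$ if $(i,j)=(r,r+1)$; $q^N$ if $(i,j)=(r+1,r)$; $\delta_{i,j}I$ otherwise. For $\lambda\in(S^1)^n$ put $\lambda_0=\lambda_{n+1}=1$. For a reduced word $\omega=s_{i_1}s_{i_2}\cdots s_{i_m}$ put $$\psi^{(q)}_{\lambda,\omega}(u_{i,j})=\overline{\lambda}_{i-1}\lambda_i\sum_{k_1,\dots,k_{m-1}=1}^{n+1}\psi^{(q)}_{s_{i_1}}(u_{i,k_1})\otimes\psi^{(q)}_{s_{i_2}}(u_{k_1,k_2})\otimes\cdots\otimes\psi^{(q)}_{s_{i_m}}(u_{k_{m-1},j})$$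 on $\ell^2(\mathbb N)^{\otimes m}$. Then $\psi_{\lambda,\omega}$ is the representation of $C(SU_0(n+1))$ on $\ell^2(\mathbb N)^{\otimes m}$ determined by $$\psi_{\lambda,\omega}(z_{i,j})=\lim_{q\to0+}(-q)^{\min\{i-j,0\}}\psi^{(q)}_{\lambda,\omega}(u_{i,j}),$$ where the limits exist in operator norm and satisfy relations (1)–(9). *)

theory Defs
  imports "HOL-Analysis.Analysis" "HOL-Combinatorics.Transposition"
begin

section \<open>The Hilbert spaces \<open>\<ell>\<^sup>2\<close>\<close>

typedef 'a ell2 = "{f :: 'a \<Rightarrow> complex. (\<lambda>i. (cmod (f i))\<^sup>2) summable_on UNIV}"
  by (rule exI[of _ "\<lambda>_. 0"]) simp

setup_lifting type_definition_ell2

lemma ell2_summable: "(\<lambda>i. (cmod (Rep_ell2 x i))\<^sup>2) summable_on UNIV"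
  using Rep_ell2[of x] by simp

lemma ell2_comparison:
  fixes f :: "'a \<Rightarrow> real"
  assumes "g summable_on UNIV" "\<And>i. \<bar>f i\<bar> \<le> g i"
  shows "f summable_on UNIV"
proof -
  have "(\<lambda>i. norm (f i)) summable_on UNIV"
    by (rule summable_on_comparison_test[OF assms(1)]) (use assms(2) in auto)
  then show ?thesis by (rule abs_summable_summable)
qed

lemma cmod_add_sq_le: "(cmod (a + b))\<^sup>2 \<le> 2 * (cmod a)\<^sup>2 + 2 * (cmod b)\<^sup>2"
proof -
  have "(cmod (a + b))\<^sup>2 \<le> (cmod a + cmod b)\<^sup>2"
    by (intro power_mono norm_triangle_ineq) simp
  also have "\<dots> \<le> 2 * (cmod a)\<^sup>2 + 2 * (cmod b)\<^sup>2"
    using sum_squares_bound[of "cmod a" "cmod b"] by (simp add: power2_sum)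
  finally show ?thesis .
qed

lemma ell2_add_closed:
  assumes "(\<lambda>i. (cmod (f i))\<^sup>2) summable_on UNIV" "(\<lambda>i. (cmod (g i))\<^sup>2) summable_on UNIV"
  shows "(\<lambda>i. (cmod (f i + g i))\<^sup>2) summable_on UNIV"
  by (rule ell2_comparison[where g = "\<lambda>i. 2 * (cmod (f i))\<^sup>2 + 2 * (cmod (g i))\<^sup>2"])
     (auto intro!: summable_on_add summable_on_cmult_right assms cmod_add_sq_le)

lemma ell2_scale_closed:
  assumes "(\<lambda>i. (cmod (f i))\<^sup>2) summable_on UNIV"
  shows "(\<lambda>i. (cmod (c * f i))\<^sup>2) summable_on UNIV"
  by (simp add: norm_mult power_mult_distrib summable_on_cmult_right assms)

lemma ell2_inner_summable:
  assumes "(\<lambda>i. (cmod (f i))\<^sup>2) summable_on UNIV" "(\<lambda>i. (cmod (g i))\<^sup>2) summable_on UNIV"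
  shows "(\<lambda>i. f i \<bullet> g i) summable_on UNIV"
proof (rule ell2_comparison[where g = "\<lambda>i. (cmod (f i))\<^sup>2 + (cmod (g i))\<^sup>2"])
  show "(\<lambda>i. (cmod (f i))\<^sup>2 + (cmod (g i))\<^sup>2) summable_on UNIV"
    by (intro summable_on_add assms)
  fix i
  have "\<bar>f i \<bullet> g i\<bar> \<le> cmod (f i) * cmod (g i)" by (rule Cauchy_Schwarz_ineq2)
  also have "\<dots> \<le> (cmod (f i))\<^sup>2 + (cmod (g i))\<^sup>2"
  proof -
    have "0 \<le> cmod (f i) * cmod (g i)" by simp
    then show ?thesis
      using sum_squares_bound[of "cmod (f i)" "cmod (g i)"] unfolding mult.assoc by linarith
  qed
  finally show "\<bar>f i \<bullet> g i\<bar> \<le> (cmod (f i))\<^sup>2 + (cmod (g i))\<^sup>2" .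
qed

lift_definition ell2_cscale :: "complex \<Rightarrow> 'a ell2 \<Rightarrow> 'a ell2" (infixr "*\<^sub>C" 75)
  is "\<lambda>c f i. c * f i"
  by (simp add: ell2_scale_closed)

lift_definition ell2_restrict :: "'a set \<Rightarrow> 'a ell2 \<Rightarrow> 'a ell2"
  is "\<lambda>X f i. if i \<in> X then f i else 0"
proof -
  fix X :: "'a set" and f :: "'a \<Rightarrow> complex"
  assume f: "(\<lambda>i. (cmod (f i))\<^sup>2) summable_on UNIV"
  show "(\<lambda>i. (cmod (if i \<in> X then f i else 0))\<^sup>2) summable_on UNIV"
    by (rule ell2_comparison[where g = "\<lambda>i. (cmod (f i))\<^sup>2"]) (use f in auto)
qed

instantiation ell2 :: (type) real_vector
begin

lift_definition zero_ell2 :: "'a ell2" is "\<lambda>_. 0" by simp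
lift_definition plus_ell2 :: "'a ell2 \<Rightarrow> 'a ell2 \<Rightarrow> 'a ell2" is "\<lambda>f g i. f i + g i"
  by (simp add: ell2_add_closed)
lift_definition uminus_ell2 :: "'a ell2 \<Rightarrow> 'a ell2" is "\<lambda>f i. - f i" by simp
lift_definition minus_ell2 :: "'a ell2 \<Rightarrow> 'a ell2 \<Rightarrow> 'a ell2" is "\<lambda>f g i. f i - g i"
proof -
  fix f g :: "'a \<Rightarrow> complex"
  assume "(\<lambda>i. (cmod (f i))\<^sup>2) summable_on UNIV" "(\<lambda>i. (cmod (g i))\<^sup>2) summable_on UNIV"
  then show "(\<lambda>i. (cmod (f i - g i))\<^sup>2) summable_on UNIV"
    using ell2_add_closed[of f "\<lambda>i. - g i"] by simp
qed
lift_definition scaleR_ell2 :: "real \<Rightarrow> 'a ell2 \<Rightarrow> 'a ell2" is "\<lambda>r f i. r *\<^sub>R f i"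
  unfolding scaleR_conv_of_real by (simp add: ell2_scale_closed)

instance
proof
  fix x y z :: "'a ell2" and r s :: real
  show "x + y + z = x + (y + z)" by transfer (simp add: add.assoc)
  show "x + y = y + x" by transfer (simp add: add.commute)
  show "0 + x = x" by transfer simp
  show "- x + x = 0" by transfer simp
  show "x - y = x + - y" by transfer simp
  show "r *\<^sub>R (x + y) = r *\<^sub>R x + r *\<^sub>R y" by transfer (simp add: scaleR_right_distrib)
  show "(r + s) *\<^sub>R x = r *\<^sub>R x + s *\<^sub>R x" by transfer (simp add: scaleR_left_distrib)
  show "r *\<^sub>R s *\<^sub>R x = (r * s) *\<^sub>R x" by transfer simp
  show "1 *\<^sub>R x = x" by transfer simp
qed

end

text \<open>The real part of the complex inner product makes \<open>\<ell>\<^sup>2\<close> a real inner product space with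
  the usual norm, so that the library's operator norm on bounded linear maps is available.\<close>

instantiation ell2 :: (type) real_inner
begin

lift_definition inner_ell2 :: "'a ell2 \<Rightarrow> 'a ell2 \<Rightarrow> real" is "\<lambda>f g. \<Sum>\<^sub>\<infinity>i. f i \<bullet> g i" .

definition norm_ell2 :: "'a ell2 \<Rightarrow> real" where "norm_ell2 x = sqrt (x \<bullet> x)"
definition dist_ell2 :: "'a ell2 \<Rightarrow> 'a ell2 \<Rightarrow> real" where "dist_ell2 x y = norm (x - y)"
definition sgn_ell2 :: "'a ell2 \<Rightarrow> 'a ell2" where "sgn_ell2 x = x /\<^sub>R norm x"
definition uniformity_ell2 :: "('a ell2 \<times> 'a ell2) filter" where
  "uniformity_ell2 = (INF e\<in>{0<..}. principal {(x, y). dist x y < e})"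
definition open_ell2 :: "'a ell2 set \<Rightarrow> bool" where
  "open_ell2 U = (\<forall>x\<in>U. \<forall>\<^sub>F (x', y) in uniformity. x' = x \<longrightarrow> y \<in> U)"

instance
proof
  fix x y z :: "'a ell2" and r :: real
  show "sgn x = inverse (norm x) *\<^sub>R x" by (simp add: sgn_ell2_def)
  show "dist x y = norm (x - y)" by (rule dist_ell2_def)
  show "uniformity = (INF e\<in>{0<..}. principal {(x :: 'a ell2, y). dist x y < e})"
    by (rule uniformity_ell2_def)
  show "open U \<longleftrightarrow> (\<forall>x\<in>U. \<forall>\<^sub>F (x', y) in uniformity. x' = x \<longrightarrow> y \<in> U)" for U :: "'a ell2 set"
    by (rule open_ell2_def)
  show "x \<bullet> y = y \<bullet> x" by transfer (simp add: inner_commute)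
  show "(x + y) \<bullet> z = x \<bullet> z + y \<bullet> z"
    by transfer (simp add: inner_add_left infsum_add ell2_inner_summable)
  show "(r *\<^sub>R x) \<bullet> y = r * (x \<bullet> y)"
    by transfer (simp add: infsum_cmult_right' del: scaleR_complex.simps)
  show "0 \<le> x \<bullet> x" by transfer (simp add: infsum_nonneg)
  show "(x \<bullet> x = 0) = (x = 0)"
  proof
    assume "x \<bullet> x = 0"
    then have "Rep_ell2 x i = 0" for i
    proof -
      have "Rep_ell2 x i \<bullet> Rep_ell2 x i = 0"
        by (rule nonneg_infsum_le_0D[where A = UNIV])
           (use \<open>x \<bullet> x = 0\<close> in \<open>auto simp: inner_ell2.rep_eq intro!: ell2_inner_summable ell2_summable\<close>)
      then show ?thesis by simp
    qed
    then show "x = 0" by (simp add: Rep_ell2_inject[symmetric] zero_ell2.rep_eq fun_eq_iff)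
  next
    assume "x = 0"
    then show "x \<bullet> x = 0" by (simp add: inner_ell2.rep_eq zero_ell2.rep_eq)
  qed
  show "norm x = sqrt (x \<bullet> x)" by (rule norm_ell2_def)
qed

end

definition ell2_cinner :: "'a ell2 \<Rightarrow> 'a ell2 \<Rightarrow> complex" where
  "ell2_cinner x y = (\<Sum>\<^sub>\<infinity>i. cnj (Rep_ell2 x i) * Rep_ell2 y i)"

text \<open>The Hilbert space \<open>\<ell>\<^sup>2(X)\<close> for a subset \<open>X\<close> of the index type.\<close>

definition ell2_on :: "'a set \<Rightarrow> 'a ell2 set" where
  "ell2_on X = {x. \<forall>i. i \<notin> X \<longrightarrow> Rep_ell2 x i = 0}"

definition closed_csubspace :: "'a ell2 set \<Rightarrow> bool" where
  "closed_csubspace M \<longleftrightarrow> closed M \<and> 0 \<in> M \<and> (\<forall>x\<in>M. \<forall>y\<in>M. x + y \<in> M) \<and> (\<forall>c. \<forall>x\<in>M. c *\<^sub>C x \<in> M)"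


section \<open>Unital \<open>*\<close>-algebras and their representations\<close>

record 'a star_algebra =
  acarrier :: "'a set"
  aadd :: "'a \<Rightarrow> 'a \<Rightarrow> 'a"
  ascale :: "complex \<Rightarrow> 'a \<Rightarrow> 'a"
  amult :: "'a \<Rightarrow> 'a \<Rightarrow> 'a"
  aunit :: 'a
  astar :: "'a \<Rightarrow> 'a"

type_synonym 'a operator = "'a ell2 \<Rightarrow>\<^sub>L 'a ell2"

definition op_cscale :: "complex \<Rightarrow> 'a operator \<Rightarrow> 'a operator" where
  "op_cscale c T = Blinfun (\<lambda>x. c *\<^sub>C blinfun_apply T x)"

definition op_adj :: "'a operator \<Rightarrow> 'a operator" where
  "op_adj T = (THE T'. \<forall>x y. ell2_cinner (blinfun_apply T' x) y = ell2_cinner x (blinfun_apply T y))"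

text \<open>\<open>B(\<ell>\<^sup>2(X))\<close>. An operator on \<open>\<ell>\<^sup>2(X)\<close> is extended by \<open>0\<close> on the orthogonal complement, so that
  the unit is the projection onto \<open>\<ell>\<^sup>2(X)\<close>; this does not change the operator norm.\<close>

definition bounded_ops :: "'a set \<Rightarrow> 'a operator star_algebra" where
  "bounded_ops X =
    \<lparr>acarrier = {T. (\<forall>c x. blinfun_apply T (c *\<^sub>C x) = c *\<^sub>C blinfun_apply T x) \<and>
                    (\<forall>x. blinfun_apply T x \<in> ell2_on X) \<and>
                    (\<forall>x. blinfun_apply T (ell2_restrict X x) = blinfun_apply T x)},
     aadd = (+), ascale = op_cscale, amult = (o\<^sub>L),
     aunit = Blinfun (ell2_restrict X), astar = op_adj\<rparr>"

definition unital_star_hom :: "'a star_algebra \<Rightarrow> 'b star_algebra \<Rightarrow> ('a \<Rightarrow> 'b) \<Rightarrow> bool" where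
  "unital_star_hom A B \<phi> \<longleftrightarrow>
     (\<forall>x\<in>acarrier A. \<phi> x \<in> acarrier B) \<and>
     (\<forall>x\<in>acarrier A. \<forall>y\<in>acarrier A. \<phi> (aadd A x y) = aadd B (\<phi> x) (\<phi> y)) \<and>
     (\<forall>c. \<forall>x\<in>acarrier A. \<phi> (ascale A c x) = ascale B c (\<phi> x)) \<and>
     (\<forall>x\<in>acarrier A. \<forall>y\<in>acarrier A. \<phi> (amult A x y) = amult B (\<phi> x) (\<phi> y)) \<and>
     \<phi> (aunit A) = aunit B \<and>
     (\<forall>x\<in>acarrier A. \<phi> (astar A x) = astar B (\<phi> x))"

definition representation :: "'a star_algebra \<Rightarrow> 'b set \<Rightarrow> ('a \<Rightarrow> 'b operator) \<Rightarrow> bool" where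
  "representation A X \<pi> \<longleftrightarrow> unital_star_hom A (bounded_ops X) \<pi>"

definition irreducible_representation :: "'a star_algebra \<Rightarrow> 'b set \<Rightarrow> ('a \<Rightarrow> 'b operator) \<Rightarrow> bool" where
  "irreducible_representation A X \<pi> \<longleftrightarrow>
     representation A X \<pi> \<and> ell2_on X \<noteq> {0} \<and>
     (\<forall>M. closed_csubspace M \<and> M \<subseteq> ell2_on X \<and> (\<forall>a\<in>acarrier A. \<forall>x\<in>M. blinfun_apply (\<pi> a) x \<in> M)
        \<longrightarrow> M = {0} \<or> M = ell2_on X)"


section \<open>The \<open>C\<^sup>*\<close>-algebra \<open>C(SU\<^sub>0(n+1))\<close>\<close>

definition aprod :: "'a star_algebra \<Rightarrow> 'a list \<Rightarrow> 'a" where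
  "aprod A xs = foldr (amult A) xs (aunit A)"

definition azero :: "'a star_algebra \<Rightarrow> 'a" where
  "azero A = ascale A 0 (aunit A)"

definition asub :: "'a star_algebra \<Rightarrow> 'a \<Rightarrow> 'a \<Rightarrow> 'a" where
  "asub A x y = aadd A x (ascale A (- 1) y)"

definition SU0_relations :: "'a star_algebra \<Rightarrow> nat \<Rightarrow> (nat \<Rightarrow> nat \<Rightarrow> 'a) \<Rightarrow> bool" where
  "SU0_relations A n z \<longleftrightarrow>
    (let I = {1..n+1}; mul = amult A; P = aprod A; nul = azero A; st = astar A;
         diag = (\<lambda>s t. map (\<lambda>k. z k k) [s..<Suc t])
     in
      (\<forall>i\<in>I. \<forall>j\<in>I. \<forall>l\<in>I. j < l \<longrightarrow> mul (z i j) (z i l) = nul) \<and>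
      (\<forall>i\<in>I. \<forall>k\<in>I. \<forall>j\<in>I. i < k \<longrightarrow> mul (z i j) (z k j) = nul) \<and>
      (\<forall>i\<in>I. \<forall>k\<in>I. \<forall>j\<in>I. \<forall>l\<in>I. i < k \<and> j < l \<longrightarrow>
         mul (z i l) (z k j) = mul (z k j) (z i l)) \<and>
      (\<forall>i\<in>I. \<forall>k\<in>I. \<forall>j\<in>I. \<forall>l\<in>I. i < k \<and> j < l \<and> max i j \<ge> min k l \<longrightarrow>
         mul (z i l) (z k j) = nul) \<and>
      (\<forall>i\<in>I. \<forall>k\<in>I. \<forall>j\<in>I. \<forall>l\<in>I. i < k \<and> j < l \<and> max i j + 1 = min k l \<longrightarrow>
         asub A (mul (z i j) (z k l)) (mul (z k l) (z i j)) = mul (z i l) (z k j)) \<and>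
      (\<forall>i\<in>I. \<forall>k\<in>I. \<forall>j\<in>I. \<forall>l\<in>I. i < k \<and> j < l \<and> max i j + 1 < min k l \<longrightarrow>
         mul (z i j) (z k l) = mul (z k l) (z i j)) \<and>
      P (diag 1 (n+1)) = aunit A \<and>
      (\<forall>i\<in>I. \<forall>j\<in>I. \<forall>r\<in>I. \<forall>s\<in>I. i \<noteq> r \<and> j \<noteq> s \<longrightarrow>
         mul (z i j) (st (z r s)) = mul (st (z r s)) (z i j)) \<and>
      (\<forall>r\<in>I. \<forall>s\<in>I. r > s \<longrightarrow>
         st (z r s) = P (diag 1 (s - 1) @ map (\<lambda>k. z k (k + 1)) [s..<r] @ diag (r + 1) (n + 1))) \<and>
      (\<forall>r\<in>I. \<forall>s\<in>I. r < s \<longrightarrow>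
         st (z r s) = P (diag 1 (r - 1) @ map (\<lambda>k. z (k + 1) k) [r..<s] @ diag (s + 1) (n + 1))) \<and>
      (\<forall>r\<in>I. st (z r r) = P (diag 1 (r - 1) @ diag (r + 1) (n + 1))))"

text \<open>The universal \<open>C\<^sup>*\<close>-algebra is built in the standard way, as the norm-closed \<open>*\<close>-subalgebra
  generated by the coordinate functions inside the product of all representations of the
  relations. Representations on \<open>\<ell>\<^sup>2(\<nat>)\<close> suffice: the algebra is separable, so its norm is
  the supremum over its cyclic representations, which live on separable spaces and
  become representations on a copy of \<open>\<ell>\<^sup>2(\<nat>)\<close> after infinite amplification.\<close>

definition SU0_families :: "nat \<Rightarrow> (nat \<Rightarrow> nat \<Rightarrow> nat operator) set" where
  "SU0_families n =
     {T. (\<forall>i\<in>{1..n+1}. \<forall>j\<in>{1..n+1}. T i j \<in> acarrier (bounded_ops UNIV)) \<and>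
         SU0_relations (bounded_ops UNIV) n T}"

definition product_algebra :: "'t set \<Rightarrow> 'a star_algebra \<Rightarrow> ('t \<Rightarrow> 'a) star_algebra" where
  "product_algebra R B =
    \<lparr>acarrier = (\<Pi>\<^sub>E T\<in>R. acarrier B),
     aadd = (\<lambda>f g. \<lambda>T\<in>R. aadd B (f T) (g T)),
     ascale = (\<lambda>c f. \<lambda>T\<in>R. ascale B c (f T)),
     amult = (\<lambda>f g. \<lambda>T\<in>R. amult B (f T) (g T)),
     aunit = (\<lambda>T\<in>R. aunit B),
     astar = (\<lambda>f. \<lambda>T\<in>R. astar B (f T))\<rparr>"

inductive_set star_subalgebra_generated :: "'a star_algebra \<Rightarrow> 'a set \<Rightarrow> 'a set"
  for A :: "'a star_algebra" and G :: "'a set" where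
  "aunit A \<in> star_subalgebra_generated A G"
| "g \<in> G \<Longrightarrow> g \<in> star_subalgebra_generated A G"
| "x \<in> star_subalgebra_generated A G \<Longrightarrow> y \<in> star_subalgebra_generated A G \<Longrightarrow>
     aadd A x y \<in> star_subalgebra_generated A G"
| "x \<in> star_subalgebra_generated A G \<Longrightarrow> ascale A c x \<in> star_subalgebra_generated A G"
| "x \<in> star_subalgebra_generated A G \<Longrightarrow> y \<in> star_subalgebra_generated A G \<Longrightarrow>
     amult A x y \<in> star_subalgebra_generated A G"
| "x \<in> star_subalgebra_generated A G \<Longrightarrow> astar A x \<in> star_subalgebra_generated A G"

definition SU0_gen :: "nat \<Rightarrow> nat \<Rightarrow> nat \<Rightarrow> (nat \<Rightarrow> nat \<Rightarrow> nat operator) \<Rightarrow> nat operator" where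
  "SU0_gen n i j = (\<lambda>T\<in>SU0_families n. T i j)"

definition C_SU0 :: "nat \<Rightarrow> ((nat \<Rightarrow> nat \<Rightarrow> nat operator) \<Rightarrow> nat operator) star_algebra" where
  "C_SU0 n =
    (let A = product_algebra (SU0_families n) (bounded_ops UNIV);
         D = star_subalgebra_generated A {SU0_gen n i j | i j. i \<in> {1..n+1} \<and> j \<in> {1..n+1}}
     in A\<lparr>acarrier := {f \<in> acarrier A. \<forall>\<epsilon>>0. \<exists>g\<in>D. \<forall>T\<in>SU0_families n. norm (f T - g T) \<le> \<epsilon>}\<rparr>)"


section \<open>Words in the symmetric group\<close>

text \<open>A word \<open>s\<^bsub>i\<^sub>1\<^esub> \<dots> s\<^bsub>i\<^sub>m\<^esub>\<close> is the list \<open>[i\<^sub>1, \<dots>, i\<^sub>m]\<close>.\<close>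

definition word_perm :: "nat list \<Rightarrow> nat \<Rightarrow> nat" where
  "word_perm w = foldr (\<lambda>i p. Transposition.transpose i (i + 1) \<circ> p) w id"

definition reduced_word :: "nat \<Rightarrow> nat list \<Rightarrow> bool" where
  "reduced_word n w \<longleftrightarrow> set w \<subseteq> {1..n} \<and>
     (\<forall>v. set v \<subseteq> {1..n} \<and> word_perm v = word_perm w \<longrightarrow> length w \<le> length v)"

definition seg_word :: "nat \<Rightarrow> nat \<Rightarrow> nat list" where
  "seg_word a b = rev [a..<Suc b]"


section \<open>The representations \<open>\<psi>\<^bsub>\<lambda>,\<omega>\<^esub>\<close>\<close>

definition left_shift :: "nat operator" where
  "left_shift = Blinfun (\<lambda>x. Abs_ell2 (\<lambda>m. Rep_ell2 x (Suc m)))"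

text \<open>\<open>number_fun f\<close> is \<open>f(N)\<close>, for bounded \<open>f\<close>.\<close>

definition number_fun :: "(nat \<Rightarrow> complex) \<Rightarrow> nat operator" where
  "number_fun f = Blinfun (\<lambda>x. Abs_ell2 (\<lambda>m. f m * Rep_ell2 x m))"

definition psi_letter :: "real \<Rightarrow> nat \<Rightarrow> nat \<Rightarrow> nat \<Rightarrow> nat operator" where
  "psi_letter q r i j =
    (let R = number_fun (\<lambda>m. of_real (sqrt (1 - q ^ (2 * m)))) in
     if i = r \<and> j = r then left_shift o\<^sub>L R
     else if i = r + 1 \<and> j = r + 1 then R o\<^sub>L op_adj left_shift
     else if i = r \<and> j = r + 1 then number_fun (\<lambda>m. - of_real (q ^ (m + 1)))
     else if i = r + 1 \<and> j = r then number_fun (\<lambda>m. of_real (q ^ m))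
     else if i = j then id_blinfun else 0)"

text \<open>The tensor power \<open>\<ell>\<^sup>2(\<nat>)\<^sup>\<otimes>\<^sup>m\<close> is \<open>\<ell>\<^sup>2(\<nat>\<^sup>m)\<close>, where \<open>\<nat>\<^sup>m\<close> is the set of lists of length \<open>m\<close>.\<close>

definition multi_indices :: "nat \<Rightarrow> nat list set" where
  "multi_indices m = {l. length l = m}"

definition tensor_vec :: "nat ell2 list \<Rightarrow> nat list ell2" where
  "tensor_vec xs =
     Abs_ell2 (\<lambda>l. if length l = length xs then \<Prod>t<length xs. Rep_ell2 (xs ! t) (l ! t) else 0)"

definition tensor_op :: "nat operator list \<Rightarrow> nat list operator" where
  "tensor_op Ts =
     (THE T. T \<in> acarrier (bounded_ops (multi_indices (length Ts))) \<and>
        (\<forall>xs. length xs = length Ts \<longrightarrow>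
           blinfun_apply T (tensor_vec xs) = tensor_vec (map2 blinfun_apply Ts xs)))"

definition lam_ext :: "nat \<Rightarrow> (nat \<Rightarrow> complex) \<Rightarrow> nat \<Rightarrow> complex" where
  "lam_ext n lam i = (if i \<in> {1..n} then lam i else 1)"

text \<open>The paths \<open>(i, k\<^sub>1, \<dots>, k\<^bsub>m-1\<^esub>, j)\<close> index the sum; the word \<open>w\<close> is assumed nonempty.\<close>

definition psi_q :: "real \<Rightarrow> nat \<Rightarrow> (nat \<Rightarrow> complex) \<Rightarrow> nat list \<Rightarrow> nat \<Rightarrow> nat \<Rightarrow> nat list operator" where
  "psi_q q n lam w i j =
     op_cscale (cnj (lam_ext n lam (i - 1)) * lam_ext n lam i)
       (\<Sum>ks\<in>{ks. length ks = length w - 1 \<and> set ks \<subseteq> {1..n+1}}.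
          tensor_op (map (\<lambda>t. psi_letter q (w ! t) ((i # ks @ [j]) ! t) ((i # ks @ [j]) ! Suc t))
                         [0..<length w]))"

definition psi_gen :: "nat \<Rightarrow> (nat \<Rightarrow> complex) \<Rightarrow> nat list \<Rightarrow> nat \<Rightarrow> nat \<Rightarrow> nat list operator" where
  "psi_gen n lam w i j =
     Lim (at_right 0) (\<lambda>q. op_cscale (of_real (- q) powi min (int i - int j) 0) (psi_q q n lam w i j))"

text \<open>\<open>\<psi>\<close> is the representation \<open>\<psi>\<^bsub>\<lambda>,\<omega>\<^esub>\<close> of \<open>C(SU\<^sub>0(n+1))\<close> on \<open>\<ell>\<^sup>2(\<nat>)\<^sup>\<otimes>\<^sup>m\<close>, \<open>m = length w\<close>,
  determined by its values on the generators.\<close>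

definition is_psi :: "nat \<Rightarrow> (nat \<Rightarrow> complex) \<Rightarrow> nat list \<Rightarrow>
    (((nat \<Rightarrow> nat \<Rightarrow> nat operator) \<Rightarrow> nat operator) \<Rightarrow> nat list operator) \<Rightarrow> bool" where
  "is_psi n lam w \<psi> \<longleftrightarrow>
     representation (C_SU0 n) (multi_indices (length w)) \<psi> \<and>
     (\<forall>i\<in>{1..n+1}. \<forall>j\<in>{1..n+1}. \<psi> (SU0_gen n i j) = psi_gen n lam w i j)"

end

theory Submission
  imports Defs
begin

text \<open>
  Let \<open>M\<close> be a closed subspace that is invariant under the algebra. Since the algebra is closed
  under adjoints, the operators \<open>T\<close> such that \<open>T\<close> and its adjoint both preserve \<open>M\<close> form a
  \<open>*\<close>-closed semigroup. It suffices to find in it all matrix units \<open>\<bar>e\<^sub>f\<rangle>\<langle>e\<^sub>g\<bar>\<close> of the standard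
  basis: a nonzero vector of \<open>M\<close> has a nonzero coordinate \<open>g\<close>, so every \<open>e\<^sub>f\<close> lies in \<open>M\<close>, and these
  span a dense subspace.

  Only the generators \<open>z\<^sub>i\<^sub>j\<close> with \<open>j \<le> i\<close> and their adjoints are used. For them no power of \<open>q\<close> is
  divided out, and the limit is taken letter by letter: at \<open>q = 0\<close> the matrix of the letter \<open>s\<^sub>r\<close> is
  \<open>S\<close> and \<open>S\<^sup>*\<close> on the diagonal, \<open>0\<close> above it and the projection \<open>P\<close> onto \<open>e\<^sub>0\<close> below it. Since
  \<open>P\<close> and \<open>S\<^sup>*\<close> have orthogonal ranges, at most one path contributes to a given coordinate of the image
  of a vector, so that \<open>z\<^sub>i\<^sub>j\<close> acts like a deterministic automaton (\<open>crystal\<close>, \<open>psi_gen_low_coord\<close>).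

  The matrix units are built from right to left along the word, one segment \<open>s\<^bsub>[a,b]\<^esub>\<close> at a time
  (\<open>segment_step\<close>). Suppose that all \<open>1 \<otimes> \<bar>e\<^sub>f\<rangle>\<langle>e\<^sub>g\<bar>\<close> acting on the segments to the right are known.
  The letters to the left of the segment are smaller than \<open>b\<close>, so a path that starts at row
  \<open>b + 1\<close> reaches the segment unchanged. There it descends to some row \<open>d\<close>, with factor
  \<open>P \<otimes> \<dots> \<otimes> P \<otimes> S\<^sup>* \<otimes> 1 \<otimes> \<dots> \<otimes> 1\<close>. Compressing \<open>z\<^bsub>b+1,d\<^esub>\<close> by suitable matrix units on the
  right-hand segments removes the paths that leave the segment at any other row
  (\<open>crystal_segment\<close>). The operators obtained for \<open>d = a, \<dots>, b + 1\<close> are, for \<open>d = a\<close>, the vacuum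
  projection of the segment, and for \<open>d > a\<close>, raising operators that increase the entry at letter
  \<open>d - 1\<close> when all entries before it vanish. Applying these in turn to the vacuum, from the last
  letter of the segment to the first, gives every basis vector.
\<close>

section \<open>Basis vectors and adjoints in \<open>\<ell>\<^sup>2\<close>\<close>

lift_definition ket :: "'a \<Rightarrow> 'a ell2" is "\<lambda>i j. if j = i then 1 else 0"
proof -
  fix i :: 'a
  have "(\<lambda>j. (cmod (if j = i then 1 else 0))\<^sup>2) summable_on UNIV \<longleftrightarrow>
        (\<lambda>j. (cmod (if j = i then 1 else 0))\<^sup>2) summable_on {i}"
    by (rule summable_on_cong_neutral) auto
  then show "(\<lambda>j. (cmod (if j = i then 1 else 0))\<^sup>2) summable_on UNIV" by simp
qed

lemma ell2_eqI: "(\<And>i. Rep_ell2 x i = Rep_ell2 y i) \<Longrightarrow> x = y"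
  by (simp add: Rep_ell2_inject[symmetric] fun_eq_iff)

lemmas ell2_coord = zero_ell2.rep_eq plus_ell2.rep_eq minus_ell2.rep_eq uminus_ell2.rep_eq
  scaleR_ell2.rep_eq ell2_cscale.rep_eq ell2_restrict.rep_eq

lemma Rep_ell2_sum: "Rep_ell2 (sum f A) i = (\<Sum>a\<in>A. Rep_ell2 (f a) i)"
  by (induction A rule: infinite_finite_induct) (auto simp: ell2_coord)

lemma norm_ell2_sq: "(norm x)\<^sup>2 = (\<Sum>\<^sub>\<infinity>i. (cmod (Rep_ell2 x i))\<^sup>2)"
proof -
  have "(norm x)\<^sup>2 = inner x x" by (simp add: power2_norm_eq_inner)
  then show ?thesis by (simp add: inner_ell2.rep_eq power2_norm_eq_inner[symmetric])
qed

lemma norm_ell2_cscale: "norm (c *\<^sub>C x) = cmod c * norm x"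
proof -
  have "(norm (c *\<^sub>C x))\<^sup>2 = (cmod c * norm x)\<^sup>2"
    by (simp add: norm_ell2_sq power_mult_distrib ell2_coord norm_mult infsum_cmult_right')
  then show ?thesis by (simp add: power2_eq_iff_nonneg)
qed

lemma cscale_add_right: "c *\<^sub>C (x + y) = c *\<^sub>C x + c *\<^sub>C y"
  by (rule ell2_eqI) (simp add: ell2_coord algebra_simps)

lemma bounded_linear_cscale: "bounded_linear (\<lambda>x. c *\<^sub>C x)"
  by (rule bounded_linear_intro[where K = "cmod c"])
     (auto simp: cscale_add_right norm_ell2_cscale mult.commute
       intro!: ell2_eqI simp: ell2_coord)

lemma cinner_summable: "(\<lambda>i. cnj (Rep_ell2 x i) * Rep_ell2 y i) summable_on UNIV"
proof (rule abs_summable_summable, rule ell2_comparison)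
  show "(\<lambda>i. (cmod (Rep_ell2 x i))\<^sup>2 + (cmod (Rep_ell2 y i))\<^sup>2) summable_on UNIV"
    by (intro summable_on_add ell2_summable)
  fix i
  have "0 \<le> cmod (Rep_ell2 x i) * cmod (Rep_ell2 y i)" by simp
  then show "\<bar>cmod (cnj (Rep_ell2 x i) * Rep_ell2 y i)\<bar>
      \<le> (cmod (Rep_ell2 x i))\<^sup>2 + (cmod (Rep_ell2 y i))\<^sup>2"
    using sum_squares_bound[of "cmod (Rep_ell2 x i)" "cmod (Rep_ell2 y i)"]
    unfolding mult.assoc norm_mult complex_mod_cnj abs_mult abs_norm_cancel by linarith
qed

lemma cinner_add_left: "ell2_cinner (x + y) z = ell2_cinner x z + ell2_cinner y z"
  by (simp add: ell2_cinner_def ell2_coord ring_distribs infsum_add cinner_summable)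

lemma cinner_add_right: "ell2_cinner z (x + y) = ell2_cinner z x + ell2_cinner z y"
  by (simp add: ell2_cinner_def ell2_coord ring_distribs infsum_add cinner_summable)

lemma cinner_cscale_left: "ell2_cinner (c *\<^sub>C x) y = cnj c * ell2_cinner x y"
  by (simp add: ell2_cinner_def ell2_coord mult.assoc infsum_cmult_right')

lemma cinner_cscale_right: "ell2_cinner x (c *\<^sub>C y) = c * ell2_cinner x y"
  by (simp add: ell2_cinner_def ell2_coord mult.left_commute infsum_cmult_right')

lemma cinner_zero [simp]: "ell2_cinner 0 x = 0" "ell2_cinner x 0 = 0"
  by (simp_all add: ell2_cinner_def ell2_coord)

lemma cinner_commute: "ell2_cinner y x = cnj (ell2_cinner x y)"
  by (simp add: ell2_cinner_def infsum_cnj[symmetric] mult.commute)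

lemma cinner_ket: "ell2_cinner (ket i) x = Rep_ell2 x i"
proof -
  have "ell2_cinner (ket i) x = (\<Sum>\<^sub>\<infinity>j\<in>{i}. Rep_ell2 x j)"
    unfolding ell2_cinner_def by (rule infsum_cong_neutral) (auto simp: ket.rep_eq)
  then show ?thesis by simp
qed

definition is_adjoint :: "'a operator \<Rightarrow> 'a operator \<Rightarrow> bool" where
  "is_adjoint T T' \<longleftrightarrow>
     (\<forall>x y. ell2_cinner (blinfun_apply T' x) y = ell2_cinner x (blinfun_apply T y))"

lemma is_adjoint_sym: "is_adjoint T T' \<Longrightarrow> is_adjoint T' T"
  unfolding is_adjoint_def by (metis cinner_commute)

lemma is_adjoint_unique:
  assumes "is_adjoint T U" "is_adjoint T V"
  shows "U = V"
proof (rule blinfun_eqI, rule ell2_eqI)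
  fix x i
  have "ell2_cinner (blinfun_apply U x) (ket i) = ell2_cinner (blinfun_apply V x) (ket i)"
    using assms by (simp add: is_adjoint_def)
  then show "Rep_ell2 (blinfun_apply U x) i = Rep_ell2 (blinfun_apply V x) i"
    by (metis cinner_commute cinner_ket)
qed

lemma op_adj_eq:
  assumes "is_adjoint T T'"
  shows "op_adj T = T'"
  unfolding op_adj_def is_adjoint_def[symmetric]
  by (rule the_equality) (use assms is_adjoint_unique in blast)+

lemma is_adjoint_compose:
  assumes "is_adjoint T T'" "is_adjoint U U'"
  shows "is_adjoint (T o\<^sub>L U) (U' o\<^sub>L T')"
  using assms by (simp add: is_adjoint_def)

lemma op_cscale_apply: "blinfun_apply (op_cscale c T) x = c *\<^sub>C blinfun_apply T x"
proof -
  have "bounded_linear (\<lambda>x. c *\<^sub>C blinfun_apply T x)"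
    by (rule bounded_linear_compose[OF bounded_linear_cscale blinfun.bounded_linear_right])
  then show ?thesis by (simp add: op_cscale_def bounded_linear_Blinfun_apply)
qed

lemma is_adjoint_op_cscale:
  assumes "is_adjoint T T'"
  shows "is_adjoint (op_cscale c T) (op_cscale (cnj c) T')"
  using assms by (simp add: is_adjoint_def op_cscale_apply cinner_cscale_left cinner_cscale_right)

lemma is_adjoint_sum:
  assumes "\<And>a. a \<in> A \<Longrightarrow> is_adjoint (T a) (T' a)"
  shows "is_adjoint (\<Sum>a\<in>A. T a) (\<Sum>a\<in>A. T' a)"
  using assms
  by (induction A rule: infinite_finite_induct)
     (auto simp: is_adjoint_def blinfun.add_left cinner_add_left cinner_add_right)

text \<open>The partial sums \<open>\<Sum>i\<in>F. x\<^sub>i e\<^sub>i\<close> converge to \<open>x\<close>: the squared distance is the tail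
  of the convergent series of the \<open>\<bar>x\<^sub>i\<bar>\<^sup>2\<close>.\<close>

lemma closed_csubspace_kets:
  assumes M: "closed_csubspace M" and kets: "\<And>i. i \<in> X \<Longrightarrow> ket i \<in> M"
  shows "ell2_on X \<subseteq> M"
proof
  fix x :: "'a ell2" assume x: "x \<in> ell2_on X"
  define trunc where "trunc F = (\<Sum>i\<in>F. Rep_ell2 x i *\<^sub>C ket i)" for F
  have trunc_M: "trunc F \<in> M" if "finite F" for F
    using that
  proof (induction F)
    case empty
    then show ?case using M by (simp add: trunc_def closed_csubspace_def)
  next
    case (insert i F)
    have "Rep_ell2 x i *\<^sub>C ket i \<in> M"
    proof (cases "i \<in> X")
      case True
      then show ?thesis using M kets by (simp add: closed_csubspace_def)
    next
      case False
      then have "Rep_ell2 x i *\<^sub>C ket i = 0"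
        using x by (intro ell2_eqI) (auto simp: ell2_on_def ell2_coord)
      then show ?thesis using M by (simp add: closed_csubspace_def)
    qed
    then show ?case using insert M by (simp add: trunc_def closed_csubspace_def)
  qed
  have Rep_trunc: "Rep_ell2 (trunc F) i = (if i \<in> F then Rep_ell2 x i else 0)" if "finite F" for F i
    using that by (simp add: trunc_def Rep_ell2_sum ell2_coord ket.rep_eq if_distrib cong: if_cong)
  let ?s = "\<lambda>i. (cmod (Rep_ell2 x i))\<^sup>2"
  have dist_sq: "(norm (x - trunc F))\<^sup>2 = infsum ?s UNIV - sum ?s F" if "finite F" for F
  proof -
    have "(norm (x - trunc F))\<^sup>2 = infsum ?s (UNIV - F)"
      unfolding norm_ell2_sq
      by (rule infsum_cong_neutral) (auto simp: ell2_coord Rep_trunc that)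
    also have "\<dots> = infsum ?s UNIV - infsum ?s F"
      by (rule infsum_Diff) (use that in \<open>auto simp: ell2_summable\<close>)
    finally show ?thesis using that by simp
  qed
  have "\<exists>y\<in>M. dist y x < e" if "e > 0" for e
  proof -
    have "0 < e\<^sup>2 / 2" using that by simp
    then obtain F where F: "finite F" "dist (sum ?s F) (infsum ?s UNIV) \<le> e\<^sup>2 / 2"
      using infsum_finite_approximation[OF ell2_summable, of "e\<^sup>2 / 2" x] by blast
    have "(norm (x - trunc F))\<^sup>2 < e\<^sup>2"
      using F(2) that unfolding dist_sq[OF F(1)] dist_real_def
      by (smt (verit, best) field_sum_of_halves zero_less_power2)
    then have "norm (x - trunc F) < e"
      using that by (simp add: power_less_imp_less_base)
    then show ?thesis
      using trunc_M[OF F(1)] by (auto simp: dist_norm norm_minus_commute)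
  qed
  then have "x \<in> closure M" by (simp add: closure_approachable)
  then show "x \<in> M" using M by (simp add: closed_csubspace_def)
qed

section \<open>Weighted composition operators\<close>

text \<open>Shifts, diagonal operators, matrix units, and tensor products of these all have the form
  \<open>(x\<^sub>j) \<mapsto> (c\<^sub>j x\<^bsub>\<tau> j\<^esub>)\<close>. It is a bounded operator when \<open>c\<close> is bounded and \<open>\<tau>\<close> is injective where
  \<open>c\<close> does not vanish, and then its norm is at most the supremum of the \<open>\<bar>c\<^sub>j\<bar>\<close>; so the convergence in
  norm of such operators with a common \<open>\<tau>\<close> is uniform convergence of the weights.\<close>

definition wcomp :: "('a \<Rightarrow> complex) \<Rightarrow> ('a \<Rightarrow> 'a) \<Rightarrow> 'a operator" where
  "wcomp c \<tau> = Blinfun (\<lambda>x. Abs_ell2 (\<lambda>j. c j * Rep_ell2 x (\<tau> j)))"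

definition wbound :: "real \<Rightarrow> ('a \<Rightarrow> complex) \<Rightarrow> ('a \<Rightarrow> 'a) \<Rightarrow> bool" where
  "wbound K c \<tau> \<longleftrightarrow> 0 \<le> K \<and> (\<forall>j. cmod (c j) \<le> K) \<and> inj_on \<tau> {j. c j \<noteq> 0}"

lemma wbound_summable:
  assumes "wbound K c \<tau>"
  shows "(\<lambda>j. (cmod (c j * Rep_ell2 x (\<tau> j)))\<^sup>2) summable_on UNIV"
    and "(\<Sum>\<^sub>\<infinity>j. (cmod (c j * Rep_ell2 x (\<tau> j)))\<^sup>2) \<le> (K * norm x)\<^sup>2"
proof -
  let ?D = "{j. c j \<noteq> 0}" and ?s = "\<lambda>i. (cmod (Rep_ell2 x i))\<^sup>2"
  have inj: "inj_on \<tau> ?D" and K: "\<And>j. cmod (c j) \<le> K" "0 \<le> K"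
    using assms by (auto simp: wbound_def)
  have im: "?s summable_on (\<tau> ` ?D)"
    using ell2_summable[of x] by (rule summable_on_subset) auto
  then have "(\<lambda>j. ?s (\<tau> j)) summable_on ?D"
    using summable_on_reindex[OF inj, of ?s] by (simp add: o_def)
  then have D: "(\<lambda>j. K\<^sup>2 * ?s (\<tau> j)) summable_on ?D" by (rule summable_on_cmult_right)
  have le: "(cmod (c j * Rep_ell2 x (\<tau> j)))\<^sup>2 \<le> K\<^sup>2 * ?s (\<tau> j)" for j
    unfolding norm_mult power_mult_distrib
    by (intro mult_right_mono power_mono K) auto
  have sD: "(\<lambda>j. (cmod (c j * Rep_ell2 x (\<tau> j)))\<^sup>2) summable_on ?D"
    by (rule summable_on_comparison_test[OF D]) (use le in auto)
  have "(\<lambda>j. (cmod (c j * Rep_ell2 x (\<tau> j)))\<^sup>2) summable_on UNIV \<longleftrightarrow>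
        (\<lambda>j. (cmod (c j * Rep_ell2 x (\<tau> j)))\<^sup>2) summable_on ?D"
    by (rule summable_on_cong_neutral) auto
  then show "(\<lambda>j. (cmod (c j * Rep_ell2 x (\<tau> j)))\<^sup>2) summable_on UNIV" using sD by simp
  have "(\<Sum>\<^sub>\<infinity>j. (cmod (c j * Rep_ell2 x (\<tau> j)))\<^sup>2) = (\<Sum>\<^sub>\<infinity>j\<in>?D. (cmod (c j * Rep_ell2 x (\<tau> j)))\<^sup>2)"
    by (rule infsum_cong_neutral) auto
  also have "\<dots> \<le> (\<Sum>\<^sub>\<infinity>j\<in>?D. K\<^sup>2 * ?s (\<tau> j))" by (rule infsum_mono[OF sD D le])
  also have "\<dots> = K\<^sup>2 * infsum ?s (\<tau> ` ?D)"
    by (simp add: infsum_cmult_right' infsum_reindex[OF inj] o_def)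
  also have "\<dots> \<le> K\<^sup>2 * infsum ?s UNIV"
    by (intro mult_left_mono infsum_mono_neutral im ell2_summable) auto
  also have "\<dots> = (K * norm x)\<^sup>2" by (simp add: power_mult_distrib norm_ell2_sq)
  finally show "(\<Sum>\<^sub>\<infinity>j. (cmod (c j * Rep_ell2 x (\<tau> j)))\<^sup>2) \<le> (K * norm x)\<^sup>2" .
qed

lemma
  assumes "wbound K c \<tau>"
  shows wcomp_coord: "Rep_ell2 (blinfun_apply (wcomp c \<tau>) x) j = c j * Rep_ell2 x (\<tau> j)"
    and norm_wcomp: "norm (wcomp c \<tau>) \<le> K"
proof -
  define f where "f x = Abs_ell2 (\<lambda>j. c j * Rep_ell2 x (\<tau> j))" for x
  have Rep: "Rep_ell2 (f x) j = c j * Rep_ell2 x (\<tau> j)" for x j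
    unfolding f_def by (subst Abs_ell2_inverse) (use wbound_summable(1)[OF assms] in auto)
  have norm: "norm (f x) \<le> K * norm x" for x
  proof (rule power2_le_imp_le)
    show "(norm (f x))\<^sup>2 \<le> (K * norm x)\<^sup>2"
      unfolding norm_ell2_sq[of "f x"] Rep by (rule wbound_summable(2)[OF assms])
    show "0 \<le> K * norm x" using assms by (simp add: wbound_def)
  qed
  have "bounded_linear f"
  proof (rule bounded_linear_intro[where K = K])
    show "f (x + y) = f x + f y" for x y
      by (rule ell2_eqI) (simp add: Rep ell2_coord ring_distribs)
    show "f (r *\<^sub>R x) = r *\<^sub>R f x" for r x
      by (rule ell2_eqI) (simp add: Rep ell2_coord scaleR_conv_of_real)
    show "norm (f x) \<le> norm x * K" for x using norm[of x] by (simp only: mult.commute)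
  qed
  then have app: "blinfun_apply (wcomp c \<tau>) = f"
    by (simp add: wcomp_def f_def[abs_def] bounded_linear_Blinfun_apply)
  then show "Rep_ell2 (blinfun_apply (wcomp c \<tau>) x) j = c j * Rep_ell2 x (\<tau> j)" by (simp add: Rep)
  show "norm (wcomp c \<tau>) \<le> K"
    by (rule norm_blinfun_bound) (use assms norm in \<open>auto simp: app wbound_def\<close>)
qed

text \<open>On the supports of the weights \<open>\<tau>\<close> and \<open>\<tau>'\<close> are mutually inverse, so the identity of inner
  products is a change of the summation index.\<close>

lemma is_adjoint_wcomp:
  assumes W: "wbound K c \<tau>" and W': "wbound K' c' \<tau>'"
    and "\<And>j. c j \<noteq> 0 \<Longrightarrow> \<tau>' (\<tau> j) = j \<and> c' (\<tau> j) = cnj (c j)"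
    and "\<And>i. c' i \<noteq> 0 \<Longrightarrow> \<tau> (\<tau>' i) = i \<and> c (\<tau>' i) = cnj (c' i)"
  shows "is_adjoint (wcomp c \<tau>) (wcomp c' \<tau>')"
  unfolding is_adjoint_def
proof (intro allI)
  fix x y
  let ?D = "{j. c j \<noteq> 0}" and ?D' = "{i. c' i \<noteq> 0}"
  have bij: "bij_betw \<tau> ?D ?D'"
    by (rule bij_betw_byWitness[where f' = \<tau>'])
       (auto simp: assms(3,4))
  have "ell2_cinner (blinfun_apply (wcomp c' \<tau>') x) y
      = (\<Sum>\<^sub>\<infinity>i\<in>?D'. cnj (c' i * Rep_ell2 x (\<tau>' i)) * Rep_ell2 y i)"
    unfolding ell2_cinner_def wcomp_coord[OF W'] by (rule infsum_cong_neutral) auto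
  also have "\<dots> = (\<Sum>\<^sub>\<infinity>j\<in>?D. cnj (c' (\<tau> j) * Rep_ell2 x (\<tau>' (\<tau> j))) * Rep_ell2 y (\<tau> j))"
    by (rule infsum_reindex_bij_betw[OF bij, symmetric])
  also have "\<dots> = ell2_cinner x (blinfun_apply (wcomp c \<tau>) y)"
    unfolding ell2_cinner_def wcomp_coord[OF W] by (rule infsum_cong_neutral) (auto simp: assms(3))
  finally show "ell2_cinner (blinfun_apply (wcomp c' \<tau>') x) y
      = ell2_cinner x (blinfun_apply (wcomp c \<tau>) y)" .
qed

lemma wcomp_has_adjoint:
  assumes W: "wbound K c \<tau>"
  shows "\<exists>T'. is_adjoint (wcomp c \<tau>) T'"
proof -
  let ?D = "{j. c j \<noteq> 0}"
  define \<sigma> where "\<sigma> = inv_into ?D \<tau>"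
  define c' where "c' i = (if i \<in> \<tau> ` ?D then cnj (c (\<sigma> i)) else 0)" for i
  have inj: "inj_on \<tau> ?D" using W by (simp add: wbound_def)
  have 1: "\<sigma> (\<tau> j) = j" if "c j \<noteq> 0" for j
    unfolding \<sigma>_def using inj that by (simp add: inv_into_f_f)
  have 2: "\<tau> (\<sigma> i) = i" if "i \<in> \<tau> ` ?D" for i
    unfolding \<sigma>_def by (rule f_inv_into_f[OF that])
  have "wbound K c' \<sigma>"
    using W 1 by (auto simp: wbound_def c'_def intro!: inj_onI split: if_splits)
  moreover have "\<And>j. c j \<noteq> 0 \<Longrightarrow> \<sigma> (\<tau> j) = j \<and> c' (\<tau> j) = cnj (c j)"
    using 1 by (auto simp: c'_def)
  moreover have "\<And>i. c' i \<noteq> 0 \<Longrightarrow> \<tau> (\<sigma> i) = i \<and> c (\<sigma> i) = cnj (c' i)"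
    using 2 by (auto simp: c'_def split: if_splits)
  ultimately have "is_adjoint (wcomp c \<tau>) (wcomp c' \<sigma>)" by (rule is_adjoint_wcomp[OF W])
  then show ?thesis ..
qed

lemma wcomp_compose:
  assumes c: "wbound K c \<tau>" and d: "wbound L d \<sigma>"
  shows "wbound (K * L) (\<lambda>j. c j * d (\<tau> j)) (\<lambda>j. \<sigma> (\<tau> j))"
    and "wcomp c \<tau> o\<^sub>L wcomp d \<sigma> = wcomp (\<lambda>j. c j * d (\<tau> j)) (\<lambda>j. \<sigma> (\<tau> j))"
proof -
  show W: "wbound (K * L) (\<lambda>j. c j * d (\<tau> j)) (\<lambda>j. \<sigma> (\<tau> j))"
    using c d by (auto simp: wbound_def norm_mult inj_on_def intro!: mult_mono)
  show "wcomp c \<tau> o\<^sub>L wcomp d \<sigma> = wcomp (\<lambda>j. c j * d (\<tau> j)) (\<lambda>j. \<sigma> (\<tau> j))"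
    by (intro blinfun_eqI ell2_eqI) (simp add: wcomp_coord[OF W] wcomp_coord[OF c] wcomp_coord[OF d])
qed

lemma wcomp_carrier:
  assumes W: "wbound K c \<tau>"
    and X: "\<And>j. j \<notin> X \<Longrightarrow> c j = 0" "\<And>j. c j \<noteq> 0 \<Longrightarrow> \<tau> j \<in> X"
  shows "wcomp c \<tau> \<in> acarrier (bounded_ops X)"
proof -
  have "blinfun_apply (wcomp c \<tau>) (d *\<^sub>C x) = d *\<^sub>C blinfun_apply (wcomp c \<tau>) x" for d x
    by (rule ell2_eqI) (simp add: wcomp_coord[OF W] ell2_coord)
  moreover have "blinfun_apply (wcomp c \<tau>) x \<in> ell2_on X" for x
    using X(1) by (simp add: ell2_on_def wcomp_coord[OF W])
  moreover have "blinfun_apply (wcomp c \<tau>) (ell2_restrict X x) = blinfun_apply (wcomp c \<tau>) x" for x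
    by (rule ell2_eqI) (use X(2) in \<open>auto simp: wcomp_coord[OF W] ell2_coord\<close>)
  ultimately show ?thesis by (simp add: bounded_ops_def)
qed

text \<open>A bounded operator is determined by its values on the basis vectors.\<close>

lemma bounded_ops_eqI:
  assumes T: "T \<in> acarrier (bounded_ops X)" and U: "U \<in> acarrier (bounded_ops X)"
    and eq: "\<And>i. i \<in> X \<Longrightarrow> blinfun_apply T (ket i) = blinfun_apply U (ket i)"
  shows "T = U"
proof (rule blinfun_eqI)
  fix x
  let ?M = "{x. blinfun_apply T x = blinfun_apply U x}"
  have "closed ?M"
    by (intro closed_Collect_eq linear_continuous_on blinfun.bounded_linear_right)
  then have M: "closed_csubspace ?M"
    using T U by (auto simp: closed_csubspace_def blinfun.add_right bounded_ops_def)
  have "ell2_restrict X x \<in> ?M"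
    by (rule subsetD[OF closed_csubspace_kets[OF M, of X]])
       (auto simp: ell2_on_def ell2_coord eq)
  then show "blinfun_apply T x = blinfun_apply U x"
    using T U by (simp add: bounded_ops_def)
qed

section \<open>Tensor products of weighted composition operators\<close>

lemma lists_Suc_image: "{l. length l = Suc m} = (\<lambda>(a, l). a # l) ` (UNIV \<times> {l. length l = m})"
  by (auto simp: length_Suc_conv image_iff)

text \<open>The norm of an elementary tensor is the product of the norms of its factors; the sum over lists
  is a double sum over head and tail.\<close>

lemma tensor_summable:
  fixes xs :: "nat ell2 list"
  shows
  "(\<lambda>l. (cmod (\<Prod>t<length xs. Rep_ell2 (xs ! t) (l ! t)))\<^sup>2) summable_on {l. length l = length xs}"
proof (induction xs)
  case Nil
  have "{l :: nat list. length l = 0} = {[]}" by auto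
  then show ?case by simp
next
  case (Cons x xs)
  let ?g = "\<lambda>l. (cmod (\<Prod>t<length xs. Rep_ell2 (xs ! t) (l ! t)))\<^sup>2"
  let ?L = "{l :: nat list. length l = length xs}"
  let ?c = "\<lambda>(a :: nat, l). a # l"
  have inj: "inj_on ?c (UNIV \<times> ?L)" by (auto simp: inj_on_def)
  have "(\<lambda>(a, l). (cmod (Rep_ell2 x a))\<^sup>2 * ?g l) summable_on UNIV \<times> ?L"
  proof (rule summable_on_SigmaI)
    fix a
    show "((\<lambda>l. case (a, l) of (a, l) \<Rightarrow> (cmod (Rep_ell2 x a))\<^sup>2 * ?g l) has_sum
        (cmod (Rep_ell2 x a))\<^sup>2 * infsum ?g ?L) ?L"
      using has_sum_cmult_right[OF has_sum_infsum[OF Cons.IH]] by simp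
  qed (auto intro!: summable_on_cmult_left ell2_summable)
  moreover have "(\<lambda>l. (cmod (\<Prod>t<length (x # xs). Rep_ell2 ((x # xs) ! t) (l ! t)))\<^sup>2) \<circ> ?c
      = (\<lambda>(a, l). (cmod (Rep_ell2 x a))\<^sup>2 * ?g l)"
    by (auto simp: fun_eq_iff prod.lessThan_Suc_shift norm_mult power_mult_distrib
        simp del: prod.lessThan_Suc)
  ultimately show ?case
    by (simp only: list.size(4) add_Suc_right add_0_right lists_Suc_image summable_on_reindex[OF inj])
qed

lemma tensor_vec_coord:
  "Rep_ell2 (tensor_vec xs) l =
     (if length l = length xs then \<Prod>t<length xs. Rep_ell2 (xs ! t) (l ! t) else 0)"
proof -
  let ?f = "\<lambda>l. if length l = length xs then \<Prod>t<length xs. Rep_ell2 (xs ! t) (l ! t) else 0"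
  have "(\<lambda>l. (cmod (?f l))\<^sup>2) summable_on UNIV \<longleftrightarrow>
      (\<lambda>l. (cmod (\<Prod>t<length xs. Rep_ell2 (xs ! t) (l ! t)))\<^sup>2) summable_on {l. length l = length xs}"
    by (rule summable_on_cong_neutral) auto
  then show ?thesis
    unfolding tensor_vec_def by (subst Abs_ell2_inverse) (auto simp: tensor_summable)
qed

lemma tensor_vec_kets: "tensor_vec (map ket l) = ket l"
proof (rule ell2_eqI)
  fix l' :: "nat list"
  show "Rep_ell2 (tensor_vec (map ket l)) l' = Rep_ell2 (ket l) l'"
  proof (cases "l' = l")
    case True
    then show ?thesis by (simp add: tensor_vec_coord ket.rep_eq)
  next
    case False
    show ?thesis
    proof (cases "length l' = length l")
      case True
      then obtain t where "t < length l" "l' ! t \<noteq> l ! t" using False by (auto simp: list_eq_iff_nth_eq)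
      then have "(\<Prod>t<length l. Rep_ell2 (map ket l ! t) (l' ! t)) = 0"
        by (intro prod_zero) (auto simp: ket.rep_eq intro!: bexI[of _ t])
      then show ?thesis using False by (simp add: tensor_vec_coord ket.rep_eq)
    qed (use False in \<open>auto simp: tensor_vec_coord ket.rep_eq\<close>)
  qed
qed

definition tensor_weight :: "nat \<Rightarrow> (nat \<Rightarrow> nat \<Rightarrow> complex) \<Rightarrow> nat list \<Rightarrow> complex" where
  "tensor_weight m c l = (if length l = m then \<Prod>t<m. c t (l ! t) else 0)"

definition tensor_index :: "nat \<Rightarrow> (nat \<Rightarrow> nat \<Rightarrow> nat) \<Rightarrow> nat list \<Rightarrow> nat list" where
  "tensor_index m \<tau> l = map (\<lambda>t. \<tau> t (l ! t)) [0..<m]"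

lemma wbound_tensor:
  assumes "\<And>t. t < m \<Longrightarrow> wbound 1 (c t) (\<tau> t)"
  shows "wbound 1 (tensor_weight m c) (tensor_index m \<tau>)"
  unfolding wbound_def
proof (intro conjI allI)
  fix l
  have "(\<Prod>t<m. cmod (c t (l ! t))) \<le> 1"
    by (rule prod_le_1) (use assms in \<open>auto simp: wbound_def\<close>)
  then show "cmod (tensor_weight m c l) \<le> 1"
    by (simp add: tensor_weight_def prod_norm)
  show "inj_on (tensor_index m \<tau>) {l. tensor_weight m c l \<noteq> 0}"
  proof (rule inj_onI)
    fix l l' assume l: "l \<in> {l. tensor_weight m c l \<noteq> 0}" "l' \<in> {l. tensor_weight m c l \<noteq> 0}"
      and eq: "tensor_index m \<tau> l = tensor_index m \<tau> l'"
    have len: "length l = m" "length l' = m" using l by (auto simp: tensor_weight_def split: if_splits)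
    show "l = l'"
    proof (rule nth_equalityI)
      fix t assume "t < length l"
      then have t: "t < m" using len by simp
      have "\<tau> t (l ! t) = \<tau> t (l' ! t)"
        using arg_cong[OF eq, of "\<lambda>k. k ! t"] t by (simp add: tensor_index_def)
      moreover have "c t (l ! t) \<noteq> 0" "c t (l' ! t) \<noteq> 0"
        using l t by (auto simp: tensor_weight_def split: if_splits)
      ultimately show "l ! t = l' ! t"
        using assms[OF t] by (auto simp: wbound_def inj_on_def)
    qed (simp add: len)
  qed
qed simp

text \<open>The explicit operator acts correctly on all elementary tensors. It is the only one, since the
  basis vectors are elementary tensors and determine a bounded operator.\<close>

lemma tensor_op_wcomp:
  assumes W: "\<And>t. t < m \<Longrightarrow> wbound 1 (c t) (\<tau> t)"
  shows "tensor_op (map (\<lambda>t. wcomp (c t) (\<tau> t)) [0..<m]) = wcomp (tensor_weight m c) (tensor_index m \<tau>)"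
    (is "tensor_op ?Ts = ?W")
proof -
  let ?P = "\<lambda>T. T \<in> acarrier (bounded_ops (multi_indices (length ?Ts))) \<and>
        (\<forall>xs. length xs = length ?Ts \<longrightarrow>
           blinfun_apply T (tensor_vec xs) = tensor_vec (map2 blinfun_apply ?Ts xs))"
  note WT = wbound_tensor[of m c \<tau>, OF W]
  have P: "?P ?W"
  proof (intro conjI allI impI)
    show "?W \<in> acarrier (bounded_ops (multi_indices (length ?Ts)))"
      by (rule wcomp_carrier[OF WT])
         (auto simp: multi_indices_def tensor_weight_def tensor_index_def split: if_splits)
    fix xs :: "nat ell2 list" assume "length xs = length ?Ts"
    then have len: "length xs = m" by simp
    show "blinfun_apply ?W (tensor_vec xs) = tensor_vec (map2 blinfun_apply ?Ts xs)"
    proof (rule ell2_eqI)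
      fix l
      show "Rep_ell2 (blinfun_apply ?W (tensor_vec xs)) l
          = Rep_ell2 (tensor_vec (map2 blinfun_apply ?Ts xs)) l"
        by (simp add: wcomp_coord[OF WT] tensor_vec_coord len tensor_weight_def tensor_index_def
            wcomp_coord[OF W] prod.distrib)
    qed
  qed
  have "T = ?W" if T: "?P T" for T
  proof (rule bounded_ops_eqI)
    show "T \<in> acarrier (bounded_ops (multi_indices (length ?Ts)))"
      "?W \<in> acarrier (bounded_ops (multi_indices (length ?Ts)))" using T P by blast+
    fix l assume "l \<in> multi_indices (length ?Ts)"
    then have l: "length (map ket l) = length ?Ts" by (simp add: multi_indices_def)
    show "blinfun_apply T (ket l) = blinfun_apply ?W (ket l)"
      using conjunct2[OF T, rule_format, OF l] conjunct2[OF P, rule_format, OF l]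
      unfolding tensor_vec_kets by (rule trans[OF _ sym])
  qed
  then show ?thesis
    unfolding tensor_op_def by (rule the_equality[of ?P, OF P])
qed

section \<open>The letters\<close>

text \<open>The entries of the matrix of \<open>s\<^sub>r\<close> as weighted composition operators. Both shifts carry the
  square root inside the weight; in the lower corner the weight vanishes at \<open>m = 0\<close>, which is why the
  truncated subtraction in \<open>letter_index\<close> does no harm.\<close>

definition letter_weight :: "real \<Rightarrow> nat \<Rightarrow> nat \<Rightarrow> nat \<Rightarrow> nat \<Rightarrow> real" where
  "letter_weight q r i j m =
     (if i = r \<and> j = r then sqrt (1 - q ^ (2 * Suc m))
      else if i = r + 1 \<and> j = r + 1 then sqrt (1 - q ^ (2 * m))
      else if i = r \<and> j = r + 1 then - (q ^ (m + 1))
      else if i = r + 1 \<and> j = r then q ^ m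
      else if i = j then 1 else 0)"

definition letter_index :: "nat \<Rightarrow> nat \<Rightarrow> nat \<Rightarrow> nat \<Rightarrow> nat" where
  "letter_index r i j =
     (if i = r \<and> j = r then Suc
      else if i = r + 1 \<and> j = r + 1 then (\<lambda>m. m - 1)
      else (\<lambda>m. m))"

lemma letter_cases:
  fixes i r j :: nat
  obtains (a) "i = r" "j = r" | (b) "i = r + 1" "j = r + 1" | (c) "i = r" "j = r + 1"
    | (d) "i = r + 1" "j = r"
    | (e) "\<not> (i = r \<and> j = r)" "\<not> (i = r + 1 \<and> j = r + 1)"
        "\<not> (i = r \<and> j = r + 1)" "\<not> (i = r + 1 \<and> j = r)"
  by argo

lemma letter_weight_bound:
  assumes "0 \<le> q" "q < 1"
  shows "\<bar>letter_weight q r i j m\<bar> \<le> 1"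
proof -
  have "0 \<le> q ^ k" "q ^ k \<le> 1" for k using assms by (auto simp: power_le_one)
  then have "\<bar>sqrt (1 - q ^ k)\<bar> \<le> 1" "\<bar>q ^ k\<bar> \<le> 1" for k by (auto simp: real_sqrt_le_iff)
  note bounds = this
  show ?thesis
  proof (cases rule: letter_cases[of i r j])
    case a
    show ?thesis unfolding letter_weight_def a using bounds by (simp del: power_Suc mult_Suc_right)
  next
    case b
    show ?thesis unfolding letter_weight_def b using bounds by simp
  next
    case c
    show ?thesis unfolding letter_weight_def c using bounds[of "m + 1"] by (simp del: power_Suc)
  next
    case d
    show ?thesis unfolding letter_weight_def d using bounds by simp
  next
    case e
    note ce = e[THEN Eq_FalseI]
    show ?thesis unfolding letter_weight_def ce if_False by simp
  qed
qed

text \<open>All nonconstant entries are \<open>\<plusminus>q\<^sup>k\<close> or \<open>\<surd>(1 - q\<^sup>k)\<close>; here \<open>k = 0\<close> gives the same value for every \<open>q\<close>,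
  and for \<open>k > 0\<close> both \<open>q\<^sup>k\<close> and \<open>1 - \<surd>(1 - q\<^sup>k)\<close> are between \<open>0\<close> and \<open>q\<close>. The bound
  does not depend on \<open>m\<close>, which makes the letters converge in norm as \<open>q \<rightarrow> 0\<close>.\<close>

lemma letter_weight_diff:
  assumes "0 \<le> q" "q < 1"
  shows "\<bar>letter_weight q r i j m - letter_weight 0 r i j m\<bar> \<le> q"
proof -
  have pow: "0 \<le> q ^ Suc k" "q ^ Suc k \<le> q" for k
    using assms power_le_one[of q k] by (auto intro: mult_left_le)
  have "1 - q ^ Suc k \<le> sqrt (1 - q ^ Suc k)" "sqrt (1 - q ^ Suc k) \<le> 1" for k
  proof -
    have "0 \<le> 1 - q ^ Suc k" "1 - q ^ Suc k \<le> 1" using pow[of k] assms by linarith+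
    then have "(1 - q ^ Suc k)\<^sup>2 \<le> 1 - q ^ Suc k"
      unfolding power2_eq_square by (rule mult_left_le[rotated])
    then show "1 - q ^ Suc k \<le> sqrt (1 - q ^ Suc k)" by (rule real_le_rsqrt)
    show "sqrt (1 - q ^ Suc k) \<le> 1" using pow[of k] by simp
  qed
  then have sq: "\<bar>sqrt (1 - q ^ Suc k) - 1\<bar> \<le> q" for k
    using pow[of k] by (smt (verit, best))
  have sq1: "\<bar>sqrt (1 - q ^ (2 * Suc m)) - sqrt (1 - 0 ^ (2 * Suc m))\<bar> \<le> q"
    using sq[of "Suc (2 * m)"] by simp
  have sq2: "\<bar>sqrt (1 - q ^ (2 * m)) - sqrt (1 - 0 ^ (2 * m))\<bar> \<le> q"
    using assms sq[of "Suc (2 * (m - 1))"] by (cases m) auto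
  have sq3: "\<bar>- (q ^ (m + 1)) - - (0 ^ (m + 1))\<bar> \<le> q" using pow[of m] by simp
  have sq4: "\<bar>q ^ m - 0 ^ m\<bar> \<le> q" using pow[of "m - 1"] assms by (cases m) auto
  show ?thesis
  proof (cases rule: letter_cases[of i r j])
    case a
    show ?thesis using sq1 unfolding letter_weight_def a by simp
  next
    case b
    show ?thesis using sq2 unfolding letter_weight_def b by simp
  next
    case c
    show ?thesis using sq3 unfolding letter_weight_def c by simp
  next
    case d
    show ?thesis using sq4 unfolding letter_weight_def d by simp
  next
    case e
    note ce = e[THEN Eq_FalseI]
    show ?thesis unfolding letter_weight_def ce if_False using assms(1) by simp
  qed
qed

lemma wbound_letter:
  assumes "0 \<le> q" "q < 1"
  shows "wbound 1 (\<lambda>m. of_real (letter_weight q r i j m)) (letter_index r i j)"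
proof -
  have "inj_on (letter_index r i j) {m. letter_weight q r i j m \<noteq> 0}"
  proof (cases "i = r + 1 \<and> j = r + 1")
    case True
    then have "letter_weight q r i j 0 = 0" "letter_index r i j = (\<lambda>m. m - 1)"
      by (auto simp: letter_weight_def letter_index_def)
    moreover have "inj_on (\<lambda>m :: nat. m - 1) {m. m \<noteq> 0}" by (auto simp: inj_on_def)
    moreover have "{m. letter_weight q r i j m \<noteq> 0} \<subseteq> {m. m \<noteq> 0}"
      using \<open>letter_weight q r i j 0 = 0\<close> by (metis (mono_tags, lifting) Collect_mono)
    ultimately show ?thesis by (metis inj_on_subset)
  next
    case False
    then show ?thesis by (simp only: letter_index_def if_not_P[OF False]) simp
  qed
  then show ?thesis using letter_weight_bound[OF assms] by (simp add: wbound_def)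
qed

lemma left_shift_wcomp: "left_shift = wcomp (\<lambda>_. 1) Suc"
  by (simp add: left_shift_def wcomp_def)

lemma op_adj_left_shift: "op_adj left_shift = wcomp (\<lambda>m. if m = 0 then 0 else 1) (\<lambda>m. m - 1)"
  unfolding left_shift_wcomp
  by (rule op_adj_eq, rule is_adjoint_wcomp[where K = 1 and K' = 1])
     (auto simp: wbound_def inj_on_def split: if_splits)

lemma number_fun_wcomp: "number_fun f = wcomp f (\<lambda>m. m)"
  by (simp add: number_fun_def wcomp_def)

lemma id_blinfun_wcomp: "id_blinfun = wcomp (\<lambda>_. 1) (\<lambda>m. m)"
proof (intro blinfun_eqI ell2_eqI)
  have "wbound 1 (\<lambda>_ :: 'a. 1) (\<lambda>m. m)" by (simp add: wbound_def)
  then show "Rep_ell2 (blinfun_apply id_blinfun x) i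
      = Rep_ell2 (blinfun_apply (wcomp (\<lambda>_. 1) (\<lambda>m. m)) x) i" for x and i :: 'a
    by (simp add: wcomp_coord)
qed

lemma zero_wcomp: "0 = wcomp (\<lambda>_. 0) \<tau>"
proof (intro blinfun_eqI ell2_eqI)
  have "wbound 1 (\<lambda>_ :: 'a. 0) \<tau>" by (simp add: wbound_def)
  then show "Rep_ell2 (blinfun_apply 0 x) i
      = Rep_ell2 (blinfun_apply (wcomp (\<lambda>_. 0) \<tau>) x) i" for x and i :: 'a
    by (simp add: wcomp_coord ell2_coord)
qed

lemma psi_letter_wcomp:
  assumes "0 \<le> q" "q < 1"
  shows "psi_letter q r i j = wcomp (\<lambda>m. of_real (letter_weight q r i j m)) (letter_index r i j)"
proof -
  let ?R = "\<lambda>m. complex_of_real (sqrt (1 - q ^ (2 * m)))"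
  have "\<bar>sqrt (1 - q ^ k)\<bar> \<le> 1" for k
    using assms by (auto simp: power_le_one)
  then have R: "wbound 1 ?R (\<lambda>m. m)" by (simp add: wbound_def)
  have S: "wbound 1 (\<lambda>_. 1) Suc" by (simp add: wbound_def)
  have S': "wbound 1 (\<lambda>m. if m = 0 then 0 else 1) (\<lambda>m :: nat. m - 1)"
    by (auto simp: wbound_def inj_on_def split: if_splits)
  have R': "?R m * (if m = 0 then 0 else 1) = ?R m" for m by auto
  have eqs: "left_shift o\<^sub>L number_fun ?R = wcomp (\<lambda>m. ?R (Suc m)) Suc"
    "number_fun ?R o\<^sub>L op_adj left_shift = wcomp ?R (\<lambda>m. m - 1)"
    unfolding op_adj_left_shift number_fun_wcomp unfolding left_shift_wcomp
      wcomp_compose(2)[OF S R] wcomp_compose(2)[OF R S'] R' by simp_all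
  note defs = psi_letter_def letter_weight_def letter_index_def Let_def
  show ?thesis
  proof (cases rule: letter_cases[of i r j])
    case a
    show ?thesis unfolding defs a eqs by simp
  next
    case b
    show ?thesis unfolding defs b eqs by simp
  next
    case c
    show ?thesis unfolding defs c number_fun_wcomp by simp
  next
    case d
    show ?thesis unfolding defs d number_fun_wcomp by simp
  next
    case e
    note ce = e[THEN Eq_FalseI]
    show ?thesis
      unfolding defs ce if_False id_blinfun_wcomp zero_wcomp[of "\<lambda>m. m"]
      by (cases "i = j") simp_all
  qed
qed

section \<open>The generators on and below the diagonal\<close>

text \<open>\<open>crystal w i j x l\<close> is the coordinate at \<open>l\<close> of the path sum from row \<open>i\<close> to row \<open>j\<close> at \<open>q = 0\<close>,
  applied to the vector \<open>x\<close>, without its phase. In row \<open>r\<close> the letter \<open>r\<close> acts by \<open>S\<close>. In row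
  \<open>r + 1\<close> the coordinate \<open>m\<close> selects the branch: for \<open>m = 0\<close> only the descent, by the projection
  onto \<open>e\<^sub>0\<close>, is nonzero, and for \<open>m > 0\<close> only the stay, by \<open>S\<^sup>*\<close>.\<close>

fun crystal :: "nat list \<Rightarrow> nat \<Rightarrow> nat \<Rightarrow> (nat list \<Rightarrow> complex) \<Rightarrow> nat list \<Rightarrow> complex" where
  "crystal [] i j x l = (if i = j then x l else 0)"
| "crystal (r # w) i j x [] = 0"
| "crystal (r # w) i j x (m # l) =
     (if i = r then crystal w r j (\<lambda>l'. x (Suc m # l')) l
      else if i = r + 1 then
        (if m = 0 then crystal w r j (\<lambda>l'. x (0 # l')) l
         else crystal w (r + 1) j (\<lambda>l'. x ((m - 1) # l')) l)
      else crystal w i j (\<lambda>l'. x (m # l')) l)"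

definition paths :: "nat \<Rightarrow> nat list \<Rightarrow> nat list set" where
  "paths n w = {ks. length ks = length w - 1 \<and> set ks \<subseteq> {1..n+1}}"

definition path_weight :: "real \<Rightarrow> nat list \<Rightarrow> nat list \<Rightarrow> nat list \<Rightarrow> complex" where
  "path_weight q w p =
     tensor_weight (length w) (\<lambda>t m. of_real (letter_weight q (w ! t) (p ! t) (p ! Suc t) m))"

definition path_index :: "nat list \<Rightarrow> nat list \<Rightarrow> nat list \<Rightarrow> nat list" where
  "path_index w p = tensor_index (length w) (\<lambda>t. letter_index (w ! t) (p ! t) (p ! Suc t))"

lemma path_weight_Cons:
  "path_weight q (r # w) (i # k # p) (m # l) =
     of_real (letter_weight q r i k m) * path_weight q w (k # p) l"
  unfolding path_weight_def tensor_weight_def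
  by (simp add: prod.lessThan_Suc_shift del: prod.lessThan_Suc)

lemma path_index_Cons:
  "path_index (r # w) (i # k # p) (m # l) = letter_index r i k m # path_index w (k # p) l"
  unfolding path_index_def tensor_index_def
  by (simp add: upt_conv_Cons map_Suc_upt[symmetric] del: upt_Suc)

text \<open>Of the \<open>n + 1\<close> possible next rows, only the one chosen by the automaton has a nonzero weight.\<close>

lemma crystal_step:
  assumes "i \<in> {1..n+1}" "r \<in> {1..n}"
  shows "(\<Sum>k\<in>{1..n+1}. of_real (letter_weight 0 r i k m) *
           crystal w k j (\<lambda>l'. x (letter_index r i k m # l')) l) = crystal (r # w) i j x (m # l)"
proof -
  define k0 where "k0 = (if i = r + 1 \<and> m = 0 then r else i)"
  let ?f = "\<lambda>k. of_real (letter_weight 0 r i k m) *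
    crystal w k j (\<lambda>l'. x (letter_index r i k m # l')) l"
  have k0: "k0 \<in> {1..n+1}" using assms by (auto simp: k0_def)
  have zero: "letter_weight 0 r i k m = 0" if "k \<noteq> k0" for k
  proof (cases rule: letter_cases[of i r k])
    case a
    then show ?thesis using that by (simp add: k0_def)
  next
    case b
    show ?thesis using that unfolding k0_def letter_weight_def b by (cases m) auto
  next
    case c
    show ?thesis unfolding letter_weight_def c by simp
  next
    case d
    show ?thesis using that unfolding k0_def letter_weight_def d by (cases m) auto
  next
    case e
    note ce = e[THEN Eq_FalseI]
    have "i \<noteq> k" using that e by (auto simp: k0_def split: if_splits)
    then show ?thesis unfolding letter_weight_def ce if_False by simp
  qed
  have "sum ?f {1..n+1} = ?f k0 + sum ?f ({1..n+1} - {k0})"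
    by (rule sum.remove) (use k0 in auto)
  also have "sum ?f ({1..n+1} - {k0}) = 0"
    by (rule sum.neutral) (use zero in auto)
  also have "?f k0 = crystal (r # w) i j x (m # l)"
  proof -
    consider "i = r" | "i = r + 1" "m = 0" | m' where "i = r + 1" "m = Suc m'"
      | "i \<noteq> r" "i \<noteq> r + 1"
      by (cases m) auto
    then show ?thesis
      by cases (simp_all add: k0_def letter_weight_def letter_index_def)
  qed
  finally show ?thesis by simp
qed

lemma paths_Cons:
  assumes "w \<noteq> []"
  shows "paths n (r # w) = (\<lambda>(k, ks). k # ks) ` ({1..n+1} \<times> paths n w)"
  using assms by (cases w) (auto simp: paths_def length_Suc_conv image_iff)

lemma path_sum_crystal:
  assumes "w \<noteq> []" "set w \<subseteq> {1..n}" "i \<in> {1..n+1}" "j \<in> {1..n+1}" "length l = length w"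
  shows "(\<Sum>ks\<in>paths n w. path_weight 0 w (i # ks @ [j]) l * x (path_index w (i # ks @ [j]) l))
     = crystal w i j x l"
  using assms
proof (induction w arbitrary: i x l)
  case Nil
  then show ?case by simp
next
  case (Cons r w)
  obtain m l' where l: "l = m # l'" "length l' = length w"
    using Cons.prems(5) by (cases l) auto
  show ?case
  proof (cases "w = []")
    case True
    have l': "l' = []" using l True by simp
    have "paths n [r] = {[]}" by (auto simp: paths_def)
    then have "(\<Sum>ks\<in>paths n [r]. path_weight 0 [r] (i # ks @ [j]) [m] * x (path_index [r] (i # ks @ [j]) [m]))
       = of_real (letter_weight 0 r i j m) * x [letter_index r i j m]"
      by (simp add: path_weight_def path_index_def tensor_weight_def tensor_index_def)
    also have "\<dots> = (\<Sum>k\<in>{1..n+1}. of_real (letter_weight 0 r i k m) *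
           crystal [] k j (\<lambda>l'. x (letter_index r i k m # l')) [])"
      using Cons.prems(4) by (simp add: if_distrib[of "\<lambda>y. _ * y"] cong: if_cong)
    also have "\<dots> = crystal [r] i j x [m]"
      by (rule crystal_step) (use Cons.prems in auto)
    finally show ?thesis by (simp only: True l(1) l')
  next
    case False
    have inj: "inj_on (\<lambda>(k, ks). k # ks) ({1..n+1} \<times> paths n w)" by (auto simp: inj_on_def)
    have "(\<Sum>ks\<in>paths n (r # w). path_weight 0 (r # w) (i # ks @ [j]) l *
              x (path_index (r # w) (i # ks @ [j]) l))
       = (\<Sum>k\<in>{1..n+1}. \<Sum>ks\<in>paths n w. of_real (letter_weight 0 r i k m) *
            (path_weight 0 w (k # ks @ [j]) l' *
             x (letter_index r i k m # path_index w (k # ks @ [j]) l')))"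
      unfolding paths_Cons[OF False] sum.reindex[OF inj] sum.cartesian_product l(1)
      by (rule sum.cong) (auto simp: path_weight_Cons path_index_Cons mult.assoc)
    also have "\<dots> = (\<Sum>k\<in>{1..n+1}. of_real (letter_weight 0 r i k m) *
           crystal w k j (\<lambda>l'. x (letter_index r i k m # l')) l')"
      unfolding sum_distrib_left[symmetric]
    proof (rule sum.cong)
      fix k assume "k \<in> {1..n+1}"
      then show "of_real (letter_weight 0 r i k m) * (\<Sum>ks\<in>paths n w. path_weight 0 w (k # ks @ [j]) l' *
             x (letter_index r i k m # path_index w (k # ks @ [j]) l')) =
          of_real (letter_weight 0 r i k m) * crystal w k j (\<lambda>l'. x (letter_index r i k m # l')) l'"
        using Cons.IH[of k l' "\<lambda>l'. x (letter_index r i k m # l')"] False Cons.prems l(2) by simp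
    qed simp
    also have "\<dots> = crystal (r # w) i j x (m # l')"
      by (rule crystal_step) (use Cons.prems in auto)
    finally show ?thesis by (simp only: l(1))
  qed
qed

lemma wbound_path:
  assumes "0 \<le> q" "q < 1"
  shows "wbound 1 (path_weight q w p) (path_index w p)"
  unfolding path_weight_def path_index_def
  by (intro wbound_tensor wbound_letter assms)

lemma psi_q_wcomp:
  assumes "0 \<le> q" "q < 1"
  shows "psi_q q n lam w i j = op_cscale (cnj (lam_ext n lam (i - 1)) * lam_ext n lam i)
     (\<Sum>ks\<in>paths n w. wcomp (path_weight q w (i # ks @ [j])) (path_index w (i # ks @ [j])))"
  unfolding psi_q_def psi_letter_wcomp[OF assms] path_weight_def path_index_def paths_def
  by (subst tensor_op_wcomp) (auto intro: wbound_letter[OF assms])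

text \<open>This keeps \<open>path_index\<close> injective where the difference of the weights at \<open>q\<close> and at \<open>0\<close> does
  not vanish, so that \<open>path_weight_diff\<close> can bound the operator norm by the weights.\<close>

lemma letter_weight_nonzero:
  assumes "0 \<le> q" "q < 1" "letter_weight 0 r i j m \<noteq> 0"
  shows "letter_weight q r i j m \<noteq> 0"
proof
  assume "letter_weight q r i j m = 0"
  then have "\<bar>letter_weight 0 r i j m\<bar> < 1"
    using letter_weight_diff[OF assms(1,2), of r i j m] assms(2) by simp
  moreover have "letter_weight 0 r i j m \<in> {0, 1}"
  proof (cases rule: letter_cases[of i r j])
    case a
    show ?thesis unfolding letter_weight_def a by simp
  next
    case b
    show ?thesis unfolding letter_weight_def b by (cases m) auto
  next
    case c
    show ?thesis unfolding letter_weight_def c by simp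
  next
    case d
    show ?thesis unfolding letter_weight_def d by (cases m) auto
  next
    case e
    note ce = e[THEN Eq_FalseI]
    show ?thesis unfolding letter_weight_def ce if_False by simp
  qed
  ultimately show False using assms(3) by auto
qed

lemma wcomp_diff:
  assumes c: "wbound K c \<tau>" and d: "wbound L d \<tau>" and W: "wbound B (\<lambda>l. c l - d l) \<tau>"
  shows "wcomp c \<tau> - wcomp d \<tau> = wcomp (\<lambda>l. c l - d l) \<tau>"
  by (intro blinfun_eqI ell2_eqI)
     (simp add: wcomp_coord[OF c] wcomp_coord[OF d] wcomp_coord[OF W] blinfun.diff_left ell2_coord
       left_diff_distrib)

text \<open>A product of factors of modulus at most \<open>1\<close> changes by at most the sum of the changes of its
  factors, one for each letter.\<close>

lemma path_weight_diff:
  assumes q: "0 \<le> q" "q < 1"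
  shows "norm (wcomp (path_weight q w p) (path_index w p) - wcomp (path_weight 0 w p) (path_index w p))
     \<le> real (length w) * q"
proof -
  have "wbound (real (length w) * q) (\<lambda>l. path_weight q w p l - path_weight 0 w p l) (path_index w p)"
    unfolding wbound_def
  proof (intro conjI allI)
    show "0 \<le> real (length w) * q" using q by simp
    fix l
    show "cmod (path_weight q w p l - path_weight 0 w p l) \<le> real (length w) * q"
    proof (cases "length l = length w")
      case True
      let ?c = "\<lambda>q t. complex_of_real (letter_weight q (w ! t) (p ! t) (p ! Suc t) (l ! t))"
      have "cmod ((\<Prod>t<length w. ?c q t) - (\<Prod>t<length w. ?c 0 t))
          \<le> (\<Sum>t<length w. cmod (?c q t - ?c 0 t))"
        by (rule norm_prod_diff) (use letter_weight_bound[OF q] letter_weight_bound[of 0] in auto)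
      also have "\<dots> \<le> (\<Sum>t<length w. q)"
      proof (rule sum_mono)
        fix t
        show "cmod (?c q t - ?c 0 t) \<le> q"
          unfolding of_real_diff[symmetric] norm_of_real by (rule letter_weight_diff[OF q])
      qed
      finally show ?thesis using True by (simp add: path_weight_def tensor_weight_def)
    qed (use q in \<open>simp add: path_weight_def tensor_weight_def\<close>)
  next
    have "path_weight q w p l \<noteq> 0" if "path_weight 0 w p l \<noteq> 0" for l
      using that letter_weight_nonzero[OF q]
      by (auto simp: path_weight_def tensor_weight_def split: if_splits)
    then have "{l. path_weight q w p l - path_weight 0 w p l \<noteq> 0} \<subseteq> {l. path_weight q w p l \<noteq> 0}"
      by auto
    then show "inj_on (path_index w p) {l. path_weight q w p l - path_weight 0 w p l \<noteq> 0}"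
      using wbound_path[OF q, of w p] by (auto simp: wbound_def intro: inj_on_subset)
  qed
  then show ?thesis
    by (simp add: wcomp_diff[OF wbound_path[OF q] wbound_path] norm_wcomp)
qed

lemma bounded_linear_op_cscale: "bounded_linear (op_cscale c)"
proof (rule bounded_linear_intro[where K = "cmod c"])
  show "op_cscale c (T + U) = op_cscale c T + op_cscale c U" for T U :: "'a operator"
    by (rule blinfun_eqI) (simp add: op_cscale_apply blinfun.add_left cscale_add_right)
  show "op_cscale c (r *\<^sub>R T) = r *\<^sub>R op_cscale c T" for r and T :: "'a operator"
    by (rule blinfun_eqI, rule ell2_eqI) (simp add: op_cscale_apply blinfun.scaleR_left ell2_coord)
  show "norm (op_cscale c T) \<le> norm T * cmod c" for T :: "'a operator"
  proof (rule norm_blinfun_bound)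
    fix x
    show "norm (blinfun_apply (op_cscale c T) x) \<le> norm T * cmod c * norm x"
      using mult_left_mono[OF norm_blinfun[of T x], of "cmod c"]
      by (simp add: op_cscale_apply norm_ell2_cscale mult_ac)
  qed simp
qed

lemma op_cscale_1: "op_cscale 1 T = T"
  by (rule blinfun_eqI, rule ell2_eqI) (simp add: op_cscale_apply ell2_coord)

text \<open>For \<open>j \<le> i\<close> the rescaling exponent is \<open>0\<close>, and \<open>psi_q\<close> is continuous in norm at \<open>q = 0\<close>.\<close>

lemma psi_gen_low:
  assumes "j \<le> i"
  shows "psi_gen n lam w i j = psi_q 0 n lam w i j"
proof -
  have path: "((\<lambda>q. wcomp (path_weight q w p) (path_index w p)) \<longlongrightarrow>
      wcomp (path_weight 0 w p) (path_index w p)) (at_right 0)" for p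
  proof (rule Lim_transform2)
    show "((\<lambda>_. wcomp (path_weight 0 w p) (path_index w p)) \<longlongrightarrow>
      wcomp (path_weight 0 w p) (path_index w p)) (at_right (0 :: real))" by simp
    have "eventually (\<lambda>q :: real. q \<in> {0<..<1}) (at_right 0)"
      by (rule eventually_at_right_real) simp
    then have "eventually (\<lambda>q. norm (wcomp (path_weight 0 w p) (path_index w p)
        - wcomp (path_weight q w p) (path_index w p)) \<le> real (length w) * q) (at_right 0)"
      by eventually_elim (use path_weight_diff in \<open>auto simp: norm_minus_commute\<close>)
    moreover have "((\<lambda>q. real (length w) * q) \<longlongrightarrow> 0) (at_right 0)"
      by (auto intro!: tendsto_eq_intros)
    ultimately show "((\<lambda>q. wcomp (path_weight 0 w p) (path_index w p)
        - wcomp (path_weight q w p) (path_index w p)) \<longlongrightarrow> 0) (at_right 0)"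
      by (rule Lim_null_comparison)
  qed
  let ?F = "\<lambda>q. op_cscale (cnj (lam_ext n lam (i - 1)) * lam_ext n lam i)
     (\<Sum>ks\<in>paths n w. wcomp (path_weight q w (i # ks @ [j])) (path_index w (i # ks @ [j])))"
  have "(?F \<longlongrightarrow> ?F 0) (at_right 0)"
    by (intro bounded_linear.tendsto[OF bounded_linear_op_cscale] tendsto_sum path)
  moreover have "eventually (\<lambda>q. ?F q =
      op_cscale (of_real (- q) powi min (int i - int j) 0) (psi_q q n lam w i j)) (at_right 0)"
  proof -
    have "eventually (\<lambda>q :: real. q \<in> {0<..<1}) (at_right 0)"
      by (rule eventually_at_right_real) simp
    then show ?thesis
      by eventually_elim (use assms in \<open>simp add: psi_q_wcomp op_cscale_1 min_def\<close>)
  qed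
  ultimately have "((\<lambda>q. op_cscale (of_real (- q) powi min (int i - int j) 0) (psi_q q n lam w i j))
      \<longlongrightarrow> ?F 0) (at_right 0)"
    by (rule Lim_transform_eventually)
  then show ?thesis
    unfolding psi_gen_def by (simp add: tendsto_Lim psi_q_wcomp)
qed

lemma psi_gen_low_coord:
  assumes "j \<le> i" "w \<noteq> []" "set w \<subseteq> {1..n}" "i \<in> {1..n+1}" "j \<in> {1..n+1}"
  shows "Rep_ell2 (blinfun_apply (psi_gen n lam w i j) x) l =
     (if length l = length w
      then cnj (lam_ext n lam (i - 1)) * lam_ext n lam i * crystal w i j (Rep_ell2 x) l else 0)"
proof -
  have "Rep_ell2 (blinfun_apply (psi_gen n lam w i j) x) l =
     cnj (lam_ext n lam (i - 1)) * lam_ext n lam i *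
     (\<Sum>ks\<in>paths n w. path_weight 0 w (i # ks @ [j]) l * Rep_ell2 x (path_index w (i # ks @ [j]) l))"
    by (simp add: psi_gen_low[OF assms(1)] psi_q_wcomp op_cscale_apply ell2_coord blinfun.sum_left
        Rep_ell2_sum wcomp_coord[OF wbound_path])
  also have "(\<Sum>ks\<in>paths n w. path_weight 0 w (i # ks @ [j]) l * Rep_ell2 x (path_index w (i # ks @ [j]) l))
      = (if length l = length w then crystal w i j (Rep_ell2 x) l else 0)"
  proof (cases "length l = length w")
    case True
    then show ?thesis using path_sum_crystal[OF assms(2-5) True] by simp
  qed (simp add: path_weight_def tensor_weight_def)
  finally show ?thesis by simp
qed

lemma psi_gen_low_has_adjoint:
  assumes "j \<le> i"
  shows "\<exists>T'. is_adjoint (psi_gen n lam w i j) T'"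
proof -
  have "\<exists>T'. is_adjoint (wcomp (path_weight 0 w p) (path_index w p)) T'" for p
    by (rule wcomp_has_adjoint[OF wbound_path]) auto
  then obtain T' where "\<And>p. is_adjoint (wcomp (path_weight 0 w p) (path_index w p)) (T' p)" by metis
  then have "is_adjoint (psi_gen n lam w i j)
      (op_cscale (cnj (cnj (lam_ext n lam (i - 1)) * lam_ext n lam i)) (\<Sum>ks\<in>paths n w. T' (i # ks @ [j])))"
    by (simp only: psi_gen_low[OF assms] psi_q_wcomp[OF order_refl zero_less_one]
        is_adjoint_op_cscale is_adjoint_sum)
  then show ?thesis ..
qed

section \<open>The crystal of a segment\<close>

text \<open>At \<open>q = 0\<close> rows never increase along a path.\<close>

lemma crystal_upward: "i < j \<Longrightarrow> crystal w i j x l = 0"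
  by (induction w i j x l rule: crystal.induct) auto

lemma crystal_zero: "crystal w i j (\<lambda>_. 0) l = 0"
proof (induction w arbitrary: i l)
  case (Cons r w)
  then show ?case by (cases l) auto
qed simp

lemma crystal_skip:
  assumes "length u = length v" "\<And>r. r \<in> set v \<Longrightarrow> i \<noteq> r \<and> i \<noteq> r + 1"
  shows "crystal (v @ w) i j x (u @ l) = crystal w i j (\<lambda>l'. x (u @ l')) l"
  using assms by (induction u v arbitrary: x rule: list_induct2) auto

text \<open>Basis vectors used to isolate row \<open>d\<close>. The path that stays in row \<open>d\<close> applies \<open>S\<close> at the letters
  \<open>d\<close> and \<open>S\<^sup>*\<close> at the letters \<open>d - 1\<close>, and so moves \<open>source d w\<close> to \<open>target d w\<close>. A path that comes
  down to row \<open>d\<close> does so at a letter \<open>d\<close>, where the projection onto \<open>e\<^sub>0\<close> kills \<open>source d w\<close>.\<close>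

definition source :: "nat \<Rightarrow> nat list \<Rightarrow> nat list" where
  "source d w = map (\<lambda>r. if r = d then 1 else 0) w"

definition target :: "nat \<Rightarrow> nat list \<Rightarrow> nat list" where
  "target d w = map (\<lambda>r. if r + 1 = d then 1 else 0) w"

lemma crystal_from_above:
  assumes "d < i" "\<And>l. x l \<noteq> 0 \<Longrightarrow> l = source d w"
  shows "crystal w i d x l = 0"
  using assms
proof (induction w arbitrary: i x l)
  case (Cons r w)
  show ?case
  proof (cases l)
    case (Cons m l')
    have tail: "\<And>l'. x (m' # l') \<noteq> 0 \<Longrightarrow> l' = source d w" for m'
      using Cons.prems(2) by (fastforce simp: source_def)
    have "crystal w r d (\<lambda>l'. x (0 # l')) l' = 0" if "i = r + 1"
    proof (cases "r = d")
      case True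
      then have "(\<lambda>l'. x (0 # l')) = (\<lambda>_. 0)"
        using Cons.prems(2) by (fastforce simp: source_def)
      then show ?thesis by (simp add: crystal_zero)
    next
      case False
      then show ?thesis using Cons.prems(1) that tail by (intro Cons.IH) auto
    qed
    moreover have "crystal w i d (\<lambda>l'. x (m' # l')) l' = 0" for m'
      using Cons.prems(1) tail by (rule Cons.IH)
    ultimately show ?thesis by (auto simp: Cons)
  qed simp
qed simp

lemma crystal_stay:
  assumes "\<And>l. x l \<noteq> 0 \<Longrightarrow> l = source d w"
  shows "crystal w d d x (target d w) = x (source d w)"
  using assms
proof (induction w arbitrary: x)
  case (Cons r w)
  have "\<And>l'. x (m # l') \<noteq> 0 \<Longrightarrow> l' = source d w" for m
    using Cons.prems by (fastforce simp: source_def)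
  then have "crystal w d d (\<lambda>l'. x (m # l')) (target d w) = x (m # source d w)" for m
    by (rule Cons.IH)
  then show ?case by (auto simp: source_def target_def)
qed (simp add: source_def target_def)

text \<open>A segment entered at row \<open>B = b + 1\<close> has decreasing letters, so once a path stays at a letter
  it meets no further letter that concerns its row: it makes \<open>B - d'\<close> descents, forcing zeros, then one
  stay, forcing a nonzero entry that it lowers. The support of \<open>x\<close> in \<open>source d post\<close> excludes
  \<open>d' > d\<close>, and \<open>d' < d\<close> is excluded since paths do not ascend. For \<open>d = a\<close> there is no letter left for
  the stay, and the update at position \<open>B - a\<close>, beyond the end of \<open>v\<close>, does nothing.\<close>

lemma crystal_segment:
  assumes "a \<le> d" "d \<le> B" "length v = B - a"
    and "\<And>l. x l \<noteq> 0 \<Longrightarrow> drop (B - a) l = source d post"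
  shows "crystal (rev [a..<B] @ post) B d x (v @ target d post) =
     (if (\<forall>i<B - d. v ! i = 0) \<and> (a < d \<longrightarrow> v ! (B - d) \<noteq> 0)
      then x (v[B - d := v ! (B - d) - 1] @ source d post) else 0)"
  using assms
proof (induction B arbitrary: v x)
  case 0
  then show ?case by (simp add: crystal_stay)
next
  case (Suc B)
  show ?case
  proof (cases "a = Suc B")
    case True
    then show ?thesis using Suc.prems by (simp add: crystal_stay)
  next
    case False
    then have aB: "a \<le> B" using Suc.prems by simp
    then obtain m v' where v: "v = m # v'" "length v' = B - a"
      using Suc.prems(3) by (cases v) (auto simp: Suc_diff_le)
    have supp: "\<And>l. x (m' # l) \<noteq> 0 \<Longrightarrow> drop (B - a) l = source d post" for m'
      using Suc.prems(4)[of "m' # _"] aB by (simp add: Suc_diff_le)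
    have skip: "crystal (rev [a..<B] @ post) (Suc B) d (\<lambda>l'. x (m' # l')) (v' @ target d post)
        = crystal post (Suc B) d (\<lambda>l'. x (m' # v' @ l')) (target d post)" for m'
      by (rule crystal_skip) (auto simp: v)
    have supp': "\<And>l. x (m' # v' @ l) \<noteq> 0 \<Longrightarrow> l = source d post" for m'
      using supp[of m' "v' @ _"] by (simp add: v)
    show ?thesis
    proof (cases "d = Suc B")
      case True
      have "crystal post d d (\<lambda>l'. x (m' # v' @ l')) (target d post) = x (m' # v' @ source d post)" for m'
        using supp' by (rule crystal_stay)
      then show ?thesis using aB skip by (simp add: v crystal_upward True)
    next
      case False
      then have dB: "d \<le> B" using Suc.prems by simp
      have "crystal post (Suc B) d (\<lambda>l'. x (m' # v' @ l')) (target d post) = 0" for m'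
        using dB supp' by (intro crystal_from_above) auto
      moreover have "crystal (rev [a..<B] @ post) B d (\<lambda>l'. x (0 # l')) (v' @ target d post) =
        (if (\<forall>i<B - d. v' ! i = 0) \<and> (a < d \<longrightarrow> v' ! (B - d) \<noteq> 0)
         then x (0 # v'[B - d := v' ! (B - d) - 1] @ source d post) else 0)"
        using Suc.prems(1) dB v(2) supp by (rule Suc.IH)
      ultimately show ?thesis
        using aB dB by (auto simp: v skip Suc_diff_le All_less_Suc2)
    qed
  qed
qed

section \<open>Matrix units\<close>

text \<open>Invariance under \<open>T\<close> and its adjoint at once, so that the operators considered form a
  \<open>*\<close>-closed semigroup.\<close>

definition bipreserves :: "'a ell2 set \<Rightarrow> 'a operator \<Rightarrow> bool" where
  "bipreserves M T \<longleftrightarrow> (\<forall>x\<in>M. blinfun_apply T x \<in> M) \<and>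
     (\<exists>T'. is_adjoint T T' \<and> (\<forall>x\<in>M. blinfun_apply T' x \<in> M))"

lemma bipreserves_compose: "bipreserves M T \<Longrightarrow> bipreserves M U \<Longrightarrow> bipreserves M (T o\<^sub>L U)"
  unfolding bipreserves_def using is_adjoint_compose[of T _ U]
  by (metis blinfun_apply_blinfun_compose)

lemma bipreserves_adjoint: "bipreserves M T \<Longrightarrow> is_adjoint T T' \<Longrightarrow> bipreserves M T'"
  unfolding bipreserves_def by (metis is_adjoint_sym is_adjoint_unique)

lemma bipreserves_op_cscale:
  assumes "closed_csubspace M" "bipreserves M T"
  shows "bipreserves M (op_cscale c T)"
  using assms is_adjoint_op_cscale[of T _ c] unfolding bipreserves_def closed_csubspace_def
  by (metis op_cscale_apply)

text \<open>On lists of length \<open>m\<close>, this is the identity on the first \<open>p\<close> tensor factors times the matrix unit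
  \<open>\<bar>e\<^sub>f\<rangle>\<langle>e\<^sub>g\<bar>\<close> on the others.\<close>

definition matrix_unit :: "nat \<Rightarrow> nat \<Rightarrow> nat list \<Rightarrow> nat list \<Rightarrow> nat list operator" where
  "matrix_unit m p f g =
     wcomp (\<lambda>l. if length l = m \<and> drop p l = f then 1 else 0) (\<lambda>l. take p l @ g)"

lemma wbound_matrix_unit:
  "wbound 1 (\<lambda>l. if length l = m \<and> drop p l = f then 1 else 0) (\<lambda>l. take p l @ g)"
proof -
  have "inj_on (\<lambda>l. take p l @ g) {l. length l = m \<and> drop p l = f}"
    by (rule inj_onI) (metis (mono_tags, lifting) append_same_eq append_take_drop_id mem_Collect_eq)
  then show ?thesis by (simp add: wbound_def)
qed

lemma matrix_unit_coord:
  "Rep_ell2 (blinfun_apply (matrix_unit m p f g) x) l =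
     (if length l = m \<and> drop p l = f then Rep_ell2 x (take p l @ g) else 0)"
  by (simp add: matrix_unit_def wcomp_coord[OF wbound_matrix_unit])

lemma is_adjoint_matrix_unit:
  assumes "p \<le> m" "length f = m - p" "length g = m - p"
  shows "is_adjoint (matrix_unit m p f g) (matrix_unit m p g f)"
  unfolding matrix_unit_def
  by (rule is_adjoint_wcomp[OF wbound_matrix_unit wbound_matrix_unit])
     (use assms in \<open>auto split: if_splits\<close>)

lemma matrix_unit_compose:
  assumes "p \<le> m" "length g = m - p"
  shows "matrix_unit m p f g o\<^sub>L matrix_unit m p g h = matrix_unit m p f h"
  by (intro blinfun_eqI ell2_eqI) (use assms in \<open>auto simp: matrix_unit_coord\<close>)

lemma operator_eqI_three_blocks:
  fixes T U :: "nat list operator"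
  assumes "\<And>x l. length l \<noteq> m \<Longrightarrow> Rep_ell2 (blinfun_apply T x) l = 0"
    and "\<And>x l. length l \<noteq> m \<Longrightarrow> Rep_ell2 (blinfun_apply U x) l = 0"
    and "\<And>x u v t. length u = p \<Longrightarrow> length v = h \<Longrightarrow> length t = m - p - h \<Longrightarrow>
      Rep_ell2 (blinfun_apply T x) (u @ v @ t) = Rep_ell2 (blinfun_apply U x) (u @ v @ t)"
    and "p + h \<le> m"
  shows "T = U"
proof (intro blinfun_eqI ell2_eqI)
  fix x l
  show "Rep_ell2 (blinfun_apply T x) l = Rep_ell2 (blinfun_apply U x) l"
  proof (cases "length l = m")
    case True
    have "l = take p l @ take h (drop p l) @ drop h (drop p l)" by (simp only: append_take_drop_id)
    then show ?thesis
      using assms(3)[of "take p l" "take h (drop p l)" "drop h (drop p l)" x] assms(4) True by simp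
  qed (simp add: assms(1,2))
qed

text \<open>The induction step: from the matrix units on the factors of \<open>post\<close> to those on the factors of
  one more segment. It is enough to reach every basis vector from the vacuum, since adjoints and
  products of the resulting operators give all matrix units.\<close>

lemma segment_step:
  fixes n :: nat and lam :: "nat \<Rightarrow> complex" and w pre post :: "nat list" and a B :: nat
  assumes M: "closed_csubspace M"
    and w_def: "w = pre @ rev [a..<B] @ post"
    and lam: "\<And>i. i \<in> {1..n} \<Longrightarrow> lam i \<noteq> 0"
    and gens: "\<And>i j. j \<le> i \<Longrightarrow> i \<in> {1..n+1} \<Longrightarrow> j \<in> {1..n+1} \<Longrightarrow> bipreserves M (psi_gen n lam w i j)"
    and w: "set w \<subseteq> {1..n}"
    and a: "1 \<le> a" "a < B" and pre: "\<And>r. r \<in> set pre \<Longrightarrow> r + 1 < B"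
    and post: "\<And>f g. length f = length post \<Longrightarrow> length g = length post \<Longrightarrow>
       bipreserves M (matrix_unit (length w) (length w - length post) f g)"
    and f: "length f = length (rev [a..<B] @ post)" and g: "length g = length (rev [a..<B] @ post)"
  shows "bipreserves M (matrix_unit (length w) (length pre) f g)"
proof -
  define m p h r where "m = length w" and "p = length pre" and "h = B - a" and "r = length post"
  have m: "m = p + h + r" by (simp add: m_def w_def p_def h_def r_def)
  define vac_s vac_p where "vac_s = replicate h (0 :: nat)" and "vac_p = replicate r (0 :: nat)"
  have len [simp]: "length vac_s = h" "length vac_p = r" by (simp_all add: vac_s_def vac_p_def)
  have B: "B \<in> {1..n+1}"
  proof -
    have "B - 1 \<in> set w" using a by (auto simp: w_def)
    then have "B - 1 \<in> {1..n}" using w by blast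
    then show ?thesis by auto
  qed
  define phase where "phase = cnj (lam_ext n lam (B - 1)) * lam_ext n lam B"
  have phase: "phase \<noteq> 0" using lam by (auto simp: phase_def lam_ext_def)
  \<comment> \<open>The compression of the generator in row \<open>B\<close> and column \<open>d\<close> that leaves only the paths
    through row \<open>d\<close> at the end of the segment. For \<open>d > a\<close> it lowers an index on coordinates, hence
    raises one on basis vectors.\<close>
  define lower where "lower d = matrix_unit m (p + h) vac_p (target d post) o\<^sub>L
     (op_cscale (1 / phase) (psi_gen n lam w B d) o\<^sub>L matrix_unit m (p + h) (source d post) vac_p)" for d
  have unit: "bipreserves M (matrix_unit m (p + h) f g)" if "length f = r" "length g = r" for f g
    using post[of f g] that by (simp add: m m_def[symmetric] r_def)
  have lower: "bipreserves M (lower d)" if "a \<le> d" "d \<le> B" for d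
    unfolding lower_def
    using that a B
    by (intro bipreserves_compose bipreserves_op_cscale M gens unit)
       (auto simp: source_def target_def r_def vac_p_def)
  have lower_coord: "Rep_ell2 (blinfun_apply (lower d) x) (u @ v @ t) =
      (if t = vac_p \<and> (\<forall>i<B - d. v ! i = 0) \<and> (a < d \<longrightarrow> v ! (B - d) \<noteq> 0)
       then Rep_ell2 x (u @ v[B - d := v ! (B - d) - 1] @ vac_p) else 0)"
    if d: "a \<le> d" "d \<le> B" and uvt: "length u = p" "length v = h" "length t = r" for d x u v t
  proof -
    define y where "y = blinfun_apply (matrix_unit m (p + h) (source d post) vac_p) x"
    have lent: "length (target d post) = r" "length (source d post) = r"
      by (simp_all add: target_def source_def r_def)
    have psi: "Rep_ell2 (blinfun_apply (psi_gen n lam w B d) y) l =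
       (if length l = m then phase * crystal w B d (Rep_ell2 y) l else 0)" for l
      unfolding phase_def m_def
      by (rule psi_gen_low_coord) (use d a B w in \<open>auto simp: w_def\<close>)
    have "crystal w B d (Rep_ell2 y) (u @ v @ target d post) =
        crystal (rev [a..<B] @ post) B d (\<lambda>l. Rep_ell2 y (u @ l)) (v @ target d post)"
      unfolding w_def by (rule crystal_skip) (use uvt in \<open>auto simp: p_def dest: pre\<close>)
    also have "\<dots> = (if (\<forall>i<B - d. v ! i = 0) \<and> (a < d \<longrightarrow> v ! (B - d) \<noteq> 0)
      then Rep_ell2 y (u @ v[B - d := v ! (B - d) - 1] @ source d post) else 0)"
    proof (rule crystal_segment)
      show "\<And>l. Rep_ell2 y (u @ l) \<noteq> 0 \<Longrightarrow> drop (B - a) l = source d post"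
        using uvt by (auto simp: y_def matrix_unit_coord h_def split: if_splits)
    qed (use d uvt in \<open>auto simp: h_def\<close>)
    finally have crystal: "crystal w B d (Rep_ell2 y) (u @ v @ target d post) = \<dots>" .
    have y_coord: "Rep_ell2 y (u @ v' @ source d post) = Rep_ell2 x (u @ v' @ vac_p)" if "length v' = h" for v'
      using uvt lent that by (simp add: y_def matrix_unit_coord m)
    define C where "C \<longleftrightarrow> (\<forall>i<B - d. v ! i = 0) \<and> (a < d \<longrightarrow> v ! (B - d) \<noteq> 0)"
    show ?thesis
      unfolding C_def[symmetric] using uvt phase lent
      by (simp add: lower_def y_def[symmetric] matrix_unit_coord[of _ _ vac_p] op_cscale_apply ell2_coord
          psi crystal[folded C_def] y_coord) (simp add: m)
  qed
  have lower_outside: "Rep_ell2 (blinfun_apply (lower d) x) l = 0" if "length l \<noteq> m" for d x l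
    using that by (simp add: lower_def matrix_unit_coord)
  have raise: "bipreserves M (matrix_unit m p (v @ vac_p) (vac_s @ vac_p))" if "length v = h" for v
    using that
  proof (induction "sum_list v" arbitrary: v rule: less_induct)
    case less
    show ?case
    proof (cases "\<exists>i<h. v ! i \<noteq> 0")
      case False
      \<comment> \<open>No raising is needed: column \<open>a\<close> already gives the vacuum projection.\<close>
      then have v: "v = vac_s" using less.prems by (auto simp: vac_s_def intro: nth_equalityI)
      have "lower a = matrix_unit m p (v @ vac_p) (vac_s @ vac_p)"
      proof (rule operator_eqI_three_blocks[of m _ _ p h])
        fix x and u v' t :: "nat list" assume l: "length u = p" "length v' = h" "length t = m - p - h"
        have "(\<forall>i<h. v' ! i = 0) \<longleftrightarrow> v' = vac_s"
          using l by (simp add: vac_s_def list_eq_iff_nth_eq)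
        then show "Rep_ell2 (blinfun_apply (lower a) x) (u @ v' @ t)
            = Rep_ell2 (blinfun_apply (matrix_unit m p (v @ vac_p) (vac_s @ vac_p)) x) (u @ v' @ t)"
          using l a by (subst lower_coord) (auto simp: m matrix_unit_coord v h_def[symmetric] list_update_beyond)
      qed (auto simp: lower_outside matrix_unit_coord m)
      then show ?thesis using lower[of a] a by simp
    next
      case True
      \<comment> \<open>The first nonzero entry was the last to be raised: the entries before it are still zero.\<close>
      define c where "c = (LEAST i. i < h \<and> v ! i \<noteq> 0)"
      have c: "c < h" "v ! c \<noteq> 0" using LeastI_ex[OF True] by (auto simp: c_def)
      have below: "v ! i = 0" if "i < c" for i
        using not_less_Least[of i "\<lambda>i. i < h \<and> v ! i \<noteq> 0"] that c(1) by (auto simp: c_def)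
      define v1 where "v1 = v[c := v ! c - 1]"
      have v1: "length v1 = h" by (simp add: v1_def less.prems)
      have "sum_list v1 < sum_list v"
        using c less.prems elem_le_sum_list[of c v] by (simp add: v1_def sum_list_update)
      then have IH: "bipreserves M (matrix_unit m p (v1 @ vac_p) (vac_s @ vac_p))"
        using v1 by (rule less.hyps)
      have d: "a < B - c" "B - c \<le> B" "B - (B - c) = c" using c a by (auto simp: h_def)
      have "lower (B - c) o\<^sub>L matrix_unit m p (v1 @ vac_p) (vac_s @ vac_p) = matrix_unit m p (v @ vac_p) (vac_s @ vac_p)"
      proof (rule operator_eqI_three_blocks[of m _ _ p h])
        fix x and u v' t :: "nat list" assume l: "length u = p" "length v' = h" "length t = m - p - h"
        have "(\<forall>i<c. v' ! i = 0) \<and> v' ! c \<noteq> 0 \<and> v'[c := v' ! c - 1] = v1 \<longleftrightarrow> v' = v"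
        proof
          assume v': "(\<forall>i<c. v' ! i = 0) \<and> v' ! c \<noteq> 0 \<and> v'[c := v' ! c - 1] = v1"
          show "v' = v"
          proof (rule nth_equalityI)
            fix i assume i: "i < length v'"
            have "v'[c := v' ! c - 1] ! i = v[c := v ! c - 1] ! i" using v' by (simp add: v1_def)
            then show "v' ! i = v ! i"
              using v' c i l less.prems by (cases "i = c") auto
          qed (simp add: l less.prems)
        qed (use c below in \<open>auto simp: v1_def\<close>)
        then show "Rep_ell2 (blinfun_apply (lower (B - c) o\<^sub>L matrix_unit m p (v1 @ vac_p) (vac_s @ vac_p)) x) (u @ v' @ t)
            = Rep_ell2 (blinfun_apply (matrix_unit m p (v @ vac_p) (vac_s @ vac_p)) x) (u @ v' @ t)"
          using l d v1 less.prems
          by (simp add: lower_coord m matrix_unit_coord) auto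
      qed (auto simp: lower_outside matrix_unit_coord m)
      then show ?thesis
        using bipreserves_compose[OF lower[of "B - c"] IH] d by simp
    qed
  qed
  have full: "bipreserves M (matrix_unit m p f (vac_s @ vac_p))" if "length f = h + r" for f
  proof -
    define v t where "v = take h f" and "t = drop h f"
    have f: "f = v @ t" "length v = h" "length t = r" using that by (simp_all add: v_def t_def)
    have "matrix_unit m (p + h) t vac_p o\<^sub>L matrix_unit m p (v @ vac_p) (vac_s @ vac_p) = matrix_unit m p f (vac_s @ vac_p)"
      by (rule operator_eqI_three_blocks[of m _ _ p h]) (auto simp: matrix_unit_coord m f)
    then show ?thesis using bipreserves_compose[OF unit[of t vac_p] raise[of v]] f by simp
  qed
  have lfg: "length f = h + r" "length g = h + r" using f g by (simp_all add: h_def r_def)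
  have "is_adjoint (matrix_unit m p g (vac_s @ vac_p)) (matrix_unit m p (vac_s @ vac_p) g)"
    by (rule is_adjoint_matrix_unit) (use lfg in \<open>simp_all add: m\<close>)
  with full[OF lfg(2)] have "bipreserves M (matrix_unit m p (vac_s @ vac_p) g)"
    by (rule bipreserves_adjoint)
  with full[OF lfg(1)]
  have "bipreserves M (matrix_unit m p f (vac_s @ vac_p) o\<^sub>L matrix_unit m p (vac_s @ vac_p) g)"
    by (rule bipreserves_compose)
  also have "matrix_unit m p f (vac_s @ vac_p) o\<^sub>L matrix_unit m p (vac_s @ vac_p) g = matrix_unit m p f g"
    by (rule matrix_unit_compose) (simp_all add: m)
  finally show ?thesis by (simp only: m_def p_def)
qed

section \<open>Invariance under the generators and their adjoints\<close>

lemma bounded_ops_UNIV_carrier: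
  "T \<in> acarrier (bounded_ops UNIV) \<longleftrightarrow> (\<forall>c x. blinfun_apply T (c *\<^sub>C x) = c *\<^sub>C blinfun_apply T x)"
proof -
  have "ell2_restrict UNIV x = x" for x :: "'a ell2" by (rule ell2_eqI) (simp add: ell2_coord)
  then show ?thesis by (simp add: bounded_ops_def ell2_on_def)
qed

lemma aprod_carrier:
  assumes "set Ts \<subseteq> acarrier (bounded_ops UNIV)"
  shows "aprod (bounded_ops UNIV) Ts \<in> acarrier (bounded_ops UNIV)"
proof -
  have "ell2_restrict UNIV = (\<lambda>x :: 'a ell2. x)" by (rule ext, rule ell2_eqI) (simp add: ell2_coord)
  then have "Blinfun (ell2_restrict UNIV) = (id_blinfun :: 'a operator)"
    by (simp add: id_blinfun_def)
  then have unit: "aunit (bounded_ops UNIV) \<in> acarrier (bounded_ops (UNIV :: 'a set))"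
    by (simp add: bounded_ops_UNIV_carrier) (simp add: bounded_ops_def)
  have mult: "amult (bounded_ops UNIV) S T \<in> acarrier (bounded_ops (UNIV :: 'a set))"
    if "S \<in> acarrier (bounded_ops UNIV)" "T \<in> acarrier (bounded_ops UNIV)" for S T :: "'a operator"
    using that by (simp add: bounded_ops_UNIV_carrier) (simp add: bounded_ops_def)
  show ?thesis
    using assms by (induction Ts) (auto simp: aprod_def intro: unit mult)
qed

text \<open>The defining relations express the adjoint of a generator as a product of generators.\<close>

lemma SU0_family_adjoint:
  assumes T: "T \<in> SU0_families n" and r: "r \<in> {1..n+1}" and s: "s \<in> {1..n+1}"
  shows "op_adj (T r s) \<in> acarrier (bounded_ops UNIV)"
proof -
  have carrier: "T i j \<in> acarrier (bounded_ops UNIV)" if "i \<in> {1..n+1}" "j \<in> {1..n+1}" for i j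
    using T that by (simp add: SU0_families_def)
  have star: "astar (bounded_ops UNIV) = op_adj" by (simp add: bounded_ops_def)
  have rel: "SU0_relations (bounded_ops UNIV) n T" using T by (simp add: SU0_families_def)
  note R = rel[unfolded SU0_relations_def Let_def star]
  let ?P = "aprod (bounded_ops (UNIV :: nat set))"
  let ?diag = "\<lambda>s t. map (\<lambda>k. T k k) [s..<Suc t]"
  consider "r > s" | "r < s" | "r = s" by linarith
  then show ?thesis
  proof cases
    case 1
    have "op_adj (T r s) = ?P (?diag 1 (s - 1) @ map (\<lambda>k. T k (k + 1)) [s..<r] @ ?diag (r + 1) (n + 1))"
      using R r s 1 by blast
    also have "\<dots> \<in> acarrier (bounded_ops UNIV)"
      by (rule aprod_carrier) (use r s in \<open>auto intro!: carrier\<close>)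
    finally show ?thesis .
  next
    case 2
    have "op_adj (T r s) = ?P (?diag 1 (r - 1) @ map (\<lambda>k. T (k + 1) k) [r..<s] @ ?diag (s + 1) (n + 1))"
      using R r s 2 by blast
    also have "\<dots> \<in> acarrier (bounded_ops UNIV)"
      by (rule aprod_carrier) (use r s in \<open>auto intro!: carrier\<close>)
    finally show ?thesis .
  next
    case 3
    have "op_adj (T r r) = ?P (?diag 1 (r - 1) @ ?diag (r + 1) (n + 1))"
      using R r by blast
    also have "\<dots> \<in> acarrier (bounded_ops UNIV)"
      by (rule aprod_carrier) (use r s in \<open>auto intro!: carrier\<close>)
    finally show ?thesis using 3 by simp
  qed
qed

text \<open>The carrier asks for membership in the full product algebra as well as for approximation by the
  generated subalgebra. For the adjoint the former rests on \<open>SU0_family_adjoint\<close>.\<close>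

lemma
  assumes i: "i \<in> {1..n+1}" and j: "j \<in> {1..n+1}"
  shows SU0_gen_carrier: "SU0_gen n i j \<in> acarrier (C_SU0 n)"
    and SU0_gen_star_carrier: "astar (C_SU0 n) (SU0_gen n i j) \<in> acarrier (C_SU0 n)"
proof -
  define A where "A = product_algebra (SU0_families n) (bounded_ops (UNIV :: nat set))"
  define D where
    "D = star_subalgebra_generated A {SU0_gen n i j | i j. i \<in> {1..n+1} \<and> j \<in> {1..n+1}}"
  have C: "acarrier (C_SU0 n) =
      {f \<in> acarrier A. \<forall>\<epsilon>>0. \<exists>g\<in>D. \<forall>T\<in>SU0_families n. norm (f T - g T) \<le> \<epsilon>}"
    by (simp add: C_SU0_def A_def D_def Let_def)
  have incl: "f \<in> acarrier (C_SU0 n)" if "f \<in> D" "f \<in> acarrier A" for f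
    unfolding C using that by (auto intro!: bexI[of _ f])
  have gen: "SU0_gen n i j \<in> D"
    unfolding D_def by (rule star_subalgebra_generated.intros(2)) (use i j in blast)
  then have star: "astar A (SU0_gen n i j) \<in> D"
    unfolding D_def by (rule star_subalgebra_generated.intros(6))
  have "SU0_gen n i j \<in> acarrier A"
    using i j by (auto simp: A_def product_algebra_def SU0_gen_def SU0_families_def)
  with gen show "SU0_gen n i j \<in> acarrier (C_SU0 n)" by (rule incl)
  have "astar A (SU0_gen n i j) = (\<lambda>T\<in>SU0_families n. op_adj (T i j))"
    by (auto simp: A_def product_algebra_def SU0_gen_def bounded_ops_def)
  then have "astar A (SU0_gen n i j) \<in> acarrier A"
    using SU0_family_adjoint[OF _ i j] by (auto simp: A_def product_algebra_def)
  with star have "astar A (SU0_gen n i j) \<in> acarrier (C_SU0 n)" by (rule incl)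
  then show "astar (C_SU0 n) (SU0_gen n i j) \<in> acarrier (C_SU0 n)"
    by (simp add: C_SU0_def A_def Let_def)
qed

text \<open>\<open>op_adj\<close> is a definite description, so the existence of an adjoint of \<open>psi_gen\<close> is needed before
  the image of the adjoint generator can be recognised as it.\<close>

lemma bipreserves_psi_gen:
  assumes psi: "is_psi n lam w \<psi>"
    and M: "\<And>a x. a \<in> acarrier (C_SU0 n) \<Longrightarrow> x \<in> M \<Longrightarrow> blinfun_apply (\<psi> a) x \<in> M"
    and ij: "j \<le> i" "i \<in> {1..n+1}" "j \<in> {1..n+1}"
  shows "bipreserves M (psi_gen n lam w i j)"
proof -
  let ?z = "SU0_gen n i j"
  note carrier = SU0_gen_carrier[OF ij(2,3)] and star = SU0_gen_star_carrier[OF ij(2,3)]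
  have z: "\<psi> ?z = psi_gen n lam w i j" using psi ij by (simp add: is_psi_def)
  have "\<psi> (astar (C_SU0 n) ?z) = astar (bounded_ops (multi_indices (length w))) (\<psi> ?z)"
    using psi carrier by (simp add: is_psi_def representation_def unital_star_hom_def)
  then have adj: "\<psi> (astar (C_SU0 n) ?z) = op_adj (psi_gen n lam w i j)"
    by (simp add: bounded_ops_def z)
  obtain T' where T': "is_adjoint (psi_gen n lam w i j) T'"
    using psi_gen_low_has_adjoint[OF ij(1)] by blast
  then have "is_adjoint (psi_gen n lam w i j) (op_adj (psi_gen n lam w i j))"
    by (simp add: op_adj_eq)
  then show ?thesis
    unfolding bipreserves_def using M[OF carrier] M[OF star] by (auto simp: z adj)
qed

section \<open>Irreducibility\<close>

lemma ell2_on_trivial_or_full: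
  assumes M: "closed_csubspace M" and sub: "M \<subseteq> ell2_on (multi_indices m)"
    and units: "\<And>f g. length f = m \<Longrightarrow> length g = m \<Longrightarrow> bipreserves M (matrix_unit m 0 f g)"
  shows "M = {0} \<or> M = ell2_on (multi_indices m)"
proof (cases "M = {0}")
  case False
  have "0 \<in> M" using M by (simp add: closed_csubspace_def)
  then obtain x where x: "x \<in> M" "x \<noteq> 0" using False by blast
  then obtain g where g: "Rep_ell2 x g \<noteq> 0" by (metis ell2_eqI zero_ell2.rep_eq)
  then have lg: "length g = m" using x sub by (auto simp: ell2_on_def multi_indices_def)
  have "ket f \<in> M" if f: "f \<in> multi_indices m" for f
  proof -
    have lf: "length f = m" using f by (simp add: multi_indices_def)
    have "ket f = (1 / Rep_ell2 x g) *\<^sub>C blinfun_apply (matrix_unit m 0 f g) x"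
      by (rule ell2_eqI) (use g lf in \<open>auto simp: ket.rep_eq ell2_coord matrix_unit_coord\<close>)
    moreover have "blinfun_apply (matrix_unit m 0 f g) x \<in> M"
      using units[OF lf lg] x(1) by (simp add: bipreserves_def)
    ultimately show ?thesis using M by (simp add: closed_csubspace_def)
  qed
  then have "ell2_on (multi_indices m) \<subseteq> M" by (rule closed_csubspace_kets[OF M])
  then show ?thesis using sub by blast
qed simp

theorem theorem3p8:
  fixes n k :: nat
    and lam :: "nat \<Rightarrow> complex"
    and a b :: "nat \<Rightarrow> nat"
    and w :: "nat list"
    and \<psi> :: "((nat \<Rightarrow> nat \<Rightarrow> nat operator) \<Rightarrow> nat operator) \<Rightarrow> nat list operator"
  assumes "n \<ge> 2"
    and "\<forall>i\<in>{1..n}. cmod (lam i) = 1"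
    and "1 \<le> k" and "k \<le> n"
    and "1 \<le> b k" and "\<forall>i\<in>{1..<k}. b (i + 1) < b i" and "b 1 \<le> n"
    and "\<forall>i\<in>{1..k}. 1 \<le> a i \<and> a i \<le> b i"
    and "w = concat (map (\<lambda>i. seg_word (a i) (b i)) (rev [1..<Suc k]))"
    and "reduced_word n w"
    and "is_psi n lam w \<psi>"
  shows "irreducible_representation (C_SU0 n) (multi_indices (length w)) \<psi>"
proof -
  let ?m = "length w" and ?X = "multi_indices (length w)"
  define suffix where "suffix s = concat (map (\<lambda>i. seg_word (a i) (b i)) (rev [1..<Suc s]))" for s
  define prefix where "prefix s = concat (map (\<lambda>i. seg_word (a i) (b i)) (rev [Suc s..<Suc k]))" for s
  have suffix_Suc: "suffix (Suc s) = seg_word (a (Suc s)) (b (Suc s)) @ suffix s" for s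
    by (simp add: suffix_def)
  have split: "w = prefix s @ suffix s" if "s \<le> k" for s
  proof -
    have "[1..<Suc k] = [1..<Suc s] @ [Suc s..<Suc k]"
      using that upt_add_eq_append[of 1 "Suc s" "k - s"] by simp
    then show ?thesis
      unfolding prefix_def suffix_def assms(9) by simp
  qed
  have b_less: "b j < b i" if "1 \<le> i" "i < j" "j \<le> k" for i j
    using that(2,3)
  proof (induction j)
    case (Suc j)
    have "b (Suc j) < b j" using assms(6) that(1) Suc.prems by simp
    then show ?case using Suc by (cases "i = j") auto
  qed simp
  have b_le: "b i \<le> n" if "i \<in> {1..k}" for i
    using b_less[of 1 i] assms(7) that by (cases "i = 1") auto
  have set_w: "set w \<subseteq> {1..n}"
    using assms(8) b_le unfolding assms(9) by (force simp: seg_word_def)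
  have lam: "lam i \<noteq> 0" if "i \<in> {1..n}" for i using assms(2) that by force
  have trivial: "M = {0} \<or> M = ell2_on ?X"
    if M: "closed_csubspace M" and sub: "M \<subseteq> ell2_on ?X"
      and inv: "\<And>c x. c \<in> acarrier (C_SU0 n) \<Longrightarrow> x \<in> M \<Longrightarrow> blinfun_apply (\<psi> c) x \<in> M" for M
  proof -
    have units: "bipreserves M (matrix_unit ?m (?m - length (suffix s)) f g)"
      if "s \<le> k" "length f = length (suffix s)" "length g = length (suffix s)" for s f g
      using that
    proof (induction s arbitrary: f g)
      \<comment> \<open>With no factors to the right, the matrix unit is the projection onto the lists of length
        \<open>m\<close>, which is the identity on \<open>M\<close>.\<close>
      case 0
      then have fg: "f = []" "g = []" by (auto simp: suffix_def)
      have id: "blinfun_apply (matrix_unit ?m ?m [] []) x = x" if "x \<in> M" for x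
        using that sub
        by (intro ell2_eqI) (auto simp: matrix_unit_coord ell2_on_def multi_indices_def)
      have "is_adjoint (matrix_unit ?m ?m [] []) (matrix_unit ?m ?m [] [])"
        by (rule is_adjoint_matrix_unit) auto
      then show ?case by (auto simp: fg suffix_def bipreserves_def id)
    next
      case (Suc s)
      let ?a = "a (Suc s)" and ?B = "Suc (b (Suc s))"
      have w: "w = prefix (Suc s) @ rev [?a..<?B] @ suffix s"
        using split[of "Suc s"] Suc.prems(1) by (simp add: suffix_Suc seg_word_def)
      have "bipreserves M (matrix_unit ?m (length (prefix (Suc s))) f g)"
      proof (rule segment_step[OF M w lam _ set_w])
        show "r + 1 < ?B" if r: "r \<in> set (prefix (Suc s))" for r
        proof -
          obtain i where i: "i \<in> {Suc (Suc s)..k}" "r \<le> b i"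
            using r by (force simp: prefix_def seg_word_def less_Suc_eq_le simp del: upt_Suc)
          then show ?thesis using b_less[of "Suc s" i] by auto
        qed
        show "bipreserves M (matrix_unit ?m (?m - length (suffix s)) f g)"
          if "length f = length (suffix s)" "length g = length (suffix s)" for f g
          using Suc that by simp
        show "1 \<le> ?a" "?a < ?B" using assms(8) Suc.prems(1) by (auto simp: less_Suc_eq_le)
        show "bipreserves M (psi_gen n lam w i j)"
          if "j \<le> i" "i \<in> {1..n+1}" "j \<in> {1..n+1}" for i j
          using assms(11) inv that by (rule bipreserves_psi_gen)
      qed (use Suc.prems in \<open>simp_all add: suffix_Suc seg_word_def del: upt_Suc\<close>)
      then show ?case
        using w split[of "Suc s"] Suc.prems(1) by (metis add_diff_cancel_right' length_append)
    qed
    have "suffix k = w" by (simp only: suffix_def assms(9))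
    then show ?thesis
      using units[of k] by (intro ell2_on_trivial_or_full[OF M sub]) simp
  qed
  define vac :: "nat list" where "vac = replicate ?m 0"
  have "ket vac \<in> ell2_on ?X"
    by (auto simp: vac_def ell2_on_def ket.rep_eq multi_indices_def)
  moreover have "ket vac \<noteq> 0"
  proof
    assume "ket vac = 0"
    then have "Rep_ell2 (ket vac) vac = 0" by (simp add: zero_ell2.rep_eq)
    then show False by (simp add: ket.rep_eq)
  qed
  ultimately have nontrivial: "ell2_on ?X \<noteq> {0}" by blast
  show ?thesis
    unfolding irreducible_representation_def
  proof (intro conjI allI impI nontrivial)
    show "representation (C_SU0 n) ?X \<psi>" using assms(11) by (simp add: is_psi_def)
    show "M = {0} \<or> M = ell2_on ?X"
      if "closed_csubspace M \<and> M \<subseteq> ell2_on ?X \<and>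
        (\<forall>c\<in>acarrier (C_SU0 n). \<forall>x\<in>M. blinfun_apply (\<psi> c) x \<in> M)" for M
      by (rule trivial) (use that in auto)
  qed
qed

end
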